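(* Let $n\ge r\ge 0$. The map $\mathrm{spl}$, sending $T\in\mathrm{RAT}(n,r)$ to the collection $\{T[L]:L\in[n]/\simeq\}$, is a bijection between $\mathrm{RAT}(n,r)$ and the set of collections of packed labeled RAT whose label sets form a set partition of $[n]$ and exactly $r$ of which are of diagonal type. Moreover, for $T\in\mathrm{RAT}(n,r)$, the number of packed RAT of horizontal (resp. vertical) type in $\mathrm{spl}(T)$ equals the number of free rows (resp. free columns) of $T$.
   Context: Rhombic diagrams. For a word $w=w_1\cdots w_m\in\{0,1,2\}^m$, the rhombic diagram $\Gamma_w$ is the region bounded by two lattice paths from a common starting point: the southeast border, obtained by reading $w$ left to right with a unit step south for each $2$, southwest (vector $(-1,-1)$) for each $1$, west for each $0$; and the northwest border, consisting of (number of $0$'s) steps west, then (number of $1$'s) steps southwest, then (number of $2$'s) steps south. It is tiled by unit squares, tall rhombi (two vertical and two diagonal sides) and short rhombi (two horizontal and two diagonal sides) via the maximal tiling: if no $i$ has $w_i>w_{i+1}$ there is nothing to tile; otherwise take the smallest such $i$, tile the region of the word obtained by swapping $w_i,w_{i+1}$, and fill the remaining tile by a tall rhombus, square or short rhombus according as $(w_i,w_{i+1})=(2,1),(2,0),(1,0)$. When the southeast border edges are labeled by $\ell_1<\cdots<\ell_m$ from northeast to southwest, each edge starts a strip (maximal sequence of tiles connected through parallel edges, possibly empty) carrying its label; strips from vertical edges are rows, from horizontal edges columns, from diagonal edges diagonal strips. For labels $i<j$, the cell $(i,j)$ is the tile common to strips $i$ and $j$, if it exists. A RAT is a filling of some tiles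 with up-arrows (only in tiles of a column) and left-arrows (only in tiles of a row) such that no arrow lies in a cell pointed to by another arrow, where a left-arrow points to all other cells of its row to its west and an up-arrow to all other cells of its column to its north. A RAT of size $(m,r')$ has $m$ border steps, $r'$ of them diagonal; $\mathrm{RAT}(n,r)$ is the set of RAT of size $(n,r)$ labeled by $[n]$. A free row (column) is a row (column) containing no left-arrow (up-arrow). Splitting. For $T\in\mathrm{RAT}(n,r)$, let $\simeq$ be the smallest equivalence relation on $[n]$ with $i\simeq j$ whenever cell $(i,j)$ contains an arrow. For a set $L\subseteq[n]$, $T[L]$ is the RAT labeled by $L$ obtained by restricting $T$ to its border edges with labels in $L$ (same directions and order) and the cells $(i,j)$ with $i,j\in L$, with their contents. A labeled RAT is a RAT whose southeast border is labeled by the increasing elements of some finite set. A RAT of size $(m,r')$ is packed if it contains exactly $m-1$ arrows (which can only occur for $r'\in\{0,1\}$); a packed RAT of size $(m,0)$ is of horizontal type if its top row contains no left-arrow, and of vertical type if its leftmost column contains no up-arrow; a packed RAT of size $(m,1)$ is of diagonal type. *)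

theory Defs
  imports "HOL-Library.Disjoint_Sets"
begin

section \<open>Rhombic diagrams and the maximal tiling\<close>

text \<open>
  Words are lists over \<open>{0, 1, 2}\<close>: the step \<open>2\<close> is south, \<open>1\<close> is the diagonal southwest step,
  \<open>0\<close> is west. Positions in a word are counted from \<open>0\<close>. Every southeast border starts at the
  origin.
\<close>

fun move :: "int \<times> int \<Rightarrow> nat \<Rightarrow> int \<times> int" where
  "move (x, y) d = (if d = 0 then (x - 1, y) else if d = 1 then (x - 1, y - 1) else (x, y - 1))"

definition border_vertex :: "nat list \<Rightarrow> nat \<Rightarrow> int \<times> int" where
  "border_vertex w k = foldl move (0, 0) (take k w)"

text \<open>
  \<open>Tile p a b\<close> with \<open>a > b\<close> is the parallelogram with corners \<open>p\<close>, \<open>move p a\<close>, \<open>move p b\<close> and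
  \<open>move (move p a) b\<close>; its southeast boundary is read \<open>a, b\<close> and its northwest boundary \<open>b, a\<close>.
  For \<open>(a, b) = (2, 1), (2, 0), (1, 0)\<close> it is a tall rhombus, a square, a short rhombus.
\<close>

datatype tile = Tile (corner: "int \<times> int") (step1: nat) (step2: nat)

definition descent :: "nat list \<Rightarrow> nat \<Rightarrow> bool" where
  "descent w i \<longleftrightarrow> Suc i < length w \<and> w ! i > w ! Suc i"

definition first_descent :: "nat list \<Rightarrow> nat" where
  "first_descent w = (LEAST i. descent w i)"

definition swap_at :: "nat list \<Rightarrow> nat \<Rightarrow> nat list" where
  "swap_at w i = w[i := w ! Suc i, Suc i := w ! i]"

lemma descent_first_descent: "\<exists>i. descent w i \<Longrightarrow> descent w (first_descent w)"
  unfolding first_descent_def by (rule LeastI_ex)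

lemma swap_at_lex:
  assumes "descent w i"
  shows "(swap_at w i, w) \<in> lex less_than"
proof -
  have lt: "Suc i < length w" and gt: "w ! Suc i < w ! i"
    using assms by (auto simp: descent_def)
  let ?s = "swap_at w i"
  have len: "length ?s = length w"
    by (simp add: swap_at_def)
  have tk: "take i ?s = take i w"
    by (simp add: swap_at_def)
  have nth: "?s ! i = w ! Suc i"
    using lt by (simp add: swap_at_def)
  have "?s = take i ?s @ ?s ! i # drop (Suc i) ?s"
    using lt len by (intro id_take_nth_drop) simp
  then have s: "?s = take i w @ w ! Suc i # drop (Suc i) ?s"
    unfolding tk nth .
  have w: "w = take i w @ w ! i # drop (Suc i) w"
    using lt by (intro id_take_nth_drop) simp
  have "(w ! Suc i, w ! i) \<in> less_than"
    using gt by simp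
  with s w len show ?thesis
    unfolding lex_conv by blast
qed

function maximal_tiling :: "nat list \<Rightarrow> tile set" where
  "maximal_tiling w =
    (if \<exists>i. descent w i
     then let i = first_descent w in
       insert (Tile (border_vertex w i) (w ! i) (w ! Suc i)) (maximal_tiling (swap_at w i))
     else {})"
  by pat_completeness auto
termination
proof (relation "lex less_than")
  show "wf (lex less_than)"
    by (rule wf_lex) (rule wf_less_than)
  show "(swap_at w x, w) \<in> lex less_than" if "\<exists>i. descent w i" "x = first_descent w" for w x
    unfolding that(2) by (rule swap_at_lex[OF descent_first_descent[OF that(1)]])
qed

declare maximal_tiling.simps [simp del]


section \<open>Strips and cells\<close>

text \<open>An edge \<open>(p, d)\<close> is the segment from \<open>p\<close> to \<open>move p d\<close>.\<close>

type_synonym edge = "(int \<times> int) \<times> nat"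

text \<open>Pairs of distinct parallel sides of a tile, in both orders.\<close>

fun opposite_sides :: "tile \<Rightarrow> (edge \<times> edge) set" where
  "opposite_sides (Tile p a b) =
    {((p, a), (move p b, a)), ((move p b, a), (p, a)),
     ((p, b), (move p a, b)), ((move p a, b), (p, b))}"

inductive_set strip_edges :: "nat list \<Rightarrow> nat \<Rightarrow> edge set" for w k where
  start: "(border_vertex w k, w ! k) \<in> strip_edges w k"
| cross: "e \<in> strip_edges w k \<Longrightarrow> t \<in> maximal_tiling w \<Longrightarrow> (e, e') \<in> opposite_sides t \<Longrightarrow>
    e' \<in> strip_edges w k"

definition strip :: "nat list \<Rightarrow> nat \<Rightarrow> tile set" where
  "strip w k = {t \<in> maximal_tiling w. \<exists>e \<in> strip_edges w k. e \<in> Domain (opposite_sides t)}"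

definition is_row :: "nat list \<Rightarrow> nat \<Rightarrow> bool" where
  "is_row w k \<longleftrightarrow> k < length w \<and> w ! k = 2"

definition is_column :: "nat list \<Rightarrow> nat \<Rightarrow> bool" where
  "is_column w k \<longleftrightarrow> k < length w \<and> w ! k = 0"

text \<open>
  If the border edges are labeled increasingly by the finite set \<open>L\<close>, the label \<open>l\<close> sits on the
  edge at position \<open>rank L l\<close>.
\<close>

definition rank :: "nat set \<Rightarrow> nat \<Rightarrow> nat" where
  "rank L l = card {k \<in> L. k < l}"

definition is_cell :: "nat set \<Rightarrow> nat list \<Rightarrow> nat \<Rightarrow> nat \<Rightarrow> tile \<Rightarrow> bool" where
  "is_cell L w i j t \<longleftrightarrow> i \<in> L \<and> j \<in> L \<and> i < j \<and> t \<in> strip w (rank L i) \<inter> strip w (rank L j)"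


section \<open>Labeled RAT\<close>

datatype arrow = Left_Arrow | Up_Arrow

record labeled_filling =
  labels :: "nat set"
  word :: "nat list"
  filling :: "tile \<Rightarrow> arrow option"

text \<open>
  The tiles of a row have pairwise distinct abscissae (the row moves west by one unit at each tile),
  and the tiles of a column pairwise distinct ordinates.
\<close>

definition points_to :: "labeled_filling \<Rightarrow> tile \<Rightarrow> tile \<Rightarrow> bool" where
  "points_to T t t' \<longleftrightarrow>
    (filling T t = Some Left_Arrow \<and>
      (\<exists>k. is_row (word T) k \<and> t \<in> strip (word T) k \<and> t' \<in> strip (word T) k
        \<and> fst (corner t') < fst (corner t))) \<or>
    (filling T t = Some Up_Arrow \<and>
      (\<exists>k. is_column (word T) k \<and> t \<in> strip (word T) k \<and> t' \<in> strip (word T) k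
        \<and> snd (corner t') > snd (corner t)))"

definition labeled_RAT :: "labeled_filling \<Rightarrow> bool" where
  "labeled_RAT T \<longleftrightarrow>
    finite (labels T) \<and> length (word T) = card (labels T) \<and> set (word T) \<subseteq> {0, 1, 2} \<and>
    (\<forall>t. filling T t \<noteq> None \<longrightarrow> t \<in> maximal_tiling (word T)) \<and>
    (\<forall>t. filling T t = Some Left_Arrow \<longrightarrow> (\<exists>k. is_row (word T) k \<and> t \<in> strip (word T) k)) \<and>
    (\<forall>t. filling T t = Some Up_Arrow \<longrightarrow> (\<exists>k. is_column (word T) k \<and> t \<in> strip (word T) k)) \<and>
    (\<forall>t t'. points_to T t t' \<longrightarrow> filling T t' = None)"

definition has_size :: "labeled_filling \<Rightarrow> nat \<Rightarrow> nat \<Rightarrow> bool" where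
  "has_size T m r \<longleftrightarrow> length (word T) = m \<and> count_list (word T) 1 = r"

definition RAT :: "nat \<Rightarrow> nat \<Rightarrow> labeled_filling set" where
  "RAT n r = {T. labeled_RAT T \<and> has_size T n r \<and> labels T = {1..n}}"

definition row_free :: "labeled_filling \<Rightarrow> nat \<Rightarrow> bool" where
  "row_free T k \<longleftrightarrow> is_row (word T) k \<and> (\<forall>t \<in> strip (word T) k. filling T t \<noteq> Some Left_Arrow)"

definition column_free :: "labeled_filling \<Rightarrow> nat \<Rightarrow> bool" where
  "column_free T k \<longleftrightarrow>
    is_column (word T) k \<and> (\<forall>t \<in> strip (word T) k. filling T t \<noteq> Some Up_Arrow)"


section \<open>Packed RAT and splitting\<close>

text \<open>Stated without subtraction, so that the RAT of size \<open>(0, 0)\<close> is not packed.\<close>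

definition packed :: "labeled_filling \<Rightarrow> bool" where
  "packed T \<longleftrightarrow> labeled_RAT T \<and> Suc (card {t. filling T t \<noteq> None}) = length (word T)"

text \<open>
  The border descends from northeast to southwest, so the top row starts at the first vertical
  border edge and the leftmost column at the last horizontal one. The types require the top row,
  respectively the leftmost column, to exist: the packed RAT with a single vertical edge is not of
  vertical type.
\<close>

definition horizontal_type :: "labeled_filling \<Rightarrow> bool" where
  "horizontal_type T \<longleftrightarrow> packed T \<and> (\<exists>m. has_size T m 0) \<and>
    (\<exists>k. is_row (word T) k \<and> (\<forall>k'. is_row (word T) k' \<longrightarrow> k \<le> k') \<and>
      (\<forall>t \<in> strip (word T) k. filling T t \<noteq> Some Left_Arrow))"

definition vertical_type :: "labeled_filling \<Rightarrow> bool" where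
  "vertical_type T \<longleftrightarrow> packed T \<and> (\<exists>m. has_size T m 0) \<and>
    (\<exists>k. is_column (word T) k \<and> (\<forall>k'. is_column (word T) k' \<longrightarrow> k' \<le> k) \<and>
      (\<forall>t \<in> strip (word T) k. filling T t \<noteq> Some Up_Arrow))"

definition diagonal_type :: "labeled_filling \<Rightarrow> bool" where
  "diagonal_type T \<longleftrightarrow> packed T \<and> (\<exists>m. has_size T m 1)"

definition arrow_pairs :: "labeled_filling \<Rightarrow> (nat \<times> nat) set" where
  "arrow_pairs T = {(i, j). \<exists>t. is_cell (labels T) (word T) i j t \<and> filling T t \<noteq> None}"

definition arrow_equiv :: "labeled_filling \<Rightarrow> (nat \<times> nat) set" where
  "arrow_equiv T = \<Inter> {R. equiv (labels T) R \<and> arrow_pairs T \<subseteq> R}"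

text \<open>The word of the border edges of \<open>T\<close> with labels in \<open>L \<subseteq> labels T\<close>.\<close>

definition subword :: "labeled_filling \<Rightarrow> nat set \<Rightarrow> nat list" where
  "subword T L = map (\<lambda>l. word T ! rank (labels T) l) (sorted_list_of_set L)"

text \<open>
  \<open>same_cell T L t' t\<close>: for some \<open>i, j \<in> L\<close>, \<open>t'\<close> is the cell \<open>(i, j)\<close> of the diagram restricted to
  \<open>L\<close> and \<open>t\<close> is the cell \<open>(i, j)\<close> of \<open>T\<close>.
\<close>

definition same_cell :: "labeled_filling \<Rightarrow> nat set \<Rightarrow> tile \<Rightarrow> tile \<Rightarrow> bool" where
  "same_cell T L t' t \<longleftrightarrow>
    (\<exists>i j. is_cell L (subword T L) i j t' \<and> is_cell (labels T) (word T) i j t)"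

definition restrict_RAT :: "labeled_filling \<Rightarrow> nat set \<Rightarrow> labeled_filling" where
  "restrict_RAT T L =
    \<lparr>labels = L,
     word = subword T L,
     filling = (\<lambda>t'. if \<exists>t. same_cell T L t' t then filling T (THE t. same_cell T L t' t) else None)\<rparr>"

definition spl :: "labeled_filling \<Rightarrow> labeled_filling set" where
  "spl T = restrict_RAT T ` (labels T // arrow_equiv T)"

definition packed_collections :: "nat \<Rightarrow> nat \<Rightarrow> labeled_filling set set" where
  "packed_collections n r =
    {C. (\<forall>P \<in> C. packed P) \<and> inj_on labels C \<and> partition_on {1..n} (labels ` C) \<and>
      card {P \<in> C. diagonal_type P} = r}"

end

theory Submission
  imports Defs
begin

text \<open>
  The cells of the maximal tiling are exactly the inversions of the border word, so a RAT is the same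
  as a set of arrows on inversions. Along a row a left-arrow is the last nonempty cell, along a column
  an up-arrow is the last nonempty cell; thus every row and column carries at most one of its own
  arrows, and the arrows form a functional graph on the labels. Consecutive arrows span nested
  intervals of labels, so this graph is a forest whose roots are the free rows, the free columns and
  the diagonal edges. The classes of \<open>\<simeq>\<close> are its trees, and a RAT is packed iff it has a single root.
  As an arrow and a nonempty cell it points to lie in the same class, the RAT conditions can be
  checked tree by tree, which makes splitting reversible. The type of a tree is the direction of its
  root: without diagonal edges, two steps from a row lead to a higher row, so if the root is a row it
  is the top one, and likewise for columns.
\<close>


text \<open>Tiles carry absolute coordinates, and deleting border edges moves them. Hence the
  geometry only serves to translate a RAT into the direction \<open>dir\<close> of each label and
  the content \<open>arr\<close> of each pair of labels; these survive restriction and gluing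
  unchanged. The translation has two sides: an invariant keeping strip \<open>k\<close> inside the
  set \<open>edges k\<close>, and explicit walks showing that the strip meets every cell it should.

  Rows and columns are not symmetric. Along a row the cells appear in label order, but in the
  maximal tiling a column, going north, meets all its rows before its diagonal strips. So the
  pointing order in a column compares directions first and labels second. This is why the nesting of
  two consecutive arrows can fail when the second ends at a diagonal edge. Such an edge carries no
  arrow of its own, so the path stops there, and acyclicity asks for nesting only along paths that
  continue.\<close>

text \<open>The vertex reached from the origin by \<open>a\<close> steps \<open>0\<close>, \<open>b\<close> steps \<open>1\<close> and \<open>c\<close> steps \<open>2\<close>.\<close>

definition pt :: "nat \<Rightarrow> nat \<Rightarrow> nat \<Rightarrow> int \<times> int" where
  "pt a b c = (- (int a + int b), - (int b + int c))"

section \<open>Letter counts in prefixes of the border word\<close>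

definition cnt :: "nat list \<Rightarrow> nat \<Rightarrow> nat \<Rightarrow> nat" where
  "cnt w d k = count_list (take k w) d"

lemma cnt_0 [simp]: "cnt w d 0 = 0"
  by (simp add: cnt_def)

lemma cnt_Suc: "k < length w \<Longrightarrow> cnt w d (Suc k) = cnt w d k + (if w ! k = d then 1 else 0)"
  by (simp add: cnt_def take_Suc_conv_app_nth)

lemma cnt_mono:
  assumes "i \<le> j"
  shows "cnt w d i \<le> cnt w d j"
proof -
  have "take j w = take i w @ take (j - i) (drop i w)"
    using assms by (metis le_add_diff_inverse take_add)
  then show ?thesis by (simp add: cnt_def)
qed

lemma cnt_less:
  assumes "i < j" "j \<le> length w" "w ! i = d"
  shows "cnt w d i < cnt w d j"
  using cnt_mono[of "Suc i" j w d] assms cnt_Suc[of i w d] by simp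

text \<open>Successive occurrences of \<open>d\<close> get successive counts from 0 on. This turns
  the running index of a block of equal letters back into positions in \<open>w\<close>.\<close>

lemma cnt_image:
  "j \<le> length w \<Longrightarrow> cnt w d ` {i. i < j \<and> w ! i = d} = {..<cnt w d j}"
proof (induction j)
  case (Suc j)
  have "{i. i < Suc j \<and> w ! i = d} = {i. i < j \<and> w ! i = d} \<union> (if w ! j = d then {j} else {})"
    by (auto simp: less_Suc_eq)
  with Suc show ?case by (auto simp: cnt_Suc image_Un)
qed simp

lemma foldl_move:
  "set u \<subseteq> {0, 1, 2} \<Longrightarrow> foldl move (x, y) u =
    (x - int (count_list u 0) - int (count_list u 1), y - int (count_list u 1) - int (count_list u 2))"
  by (induction u arbitrary: x y) auto

lemma foldl_move_pt:
  "set u \<subseteq> {0, 1, 2} \<Longrightarrow>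
    foldl move (0, 0) u = pt (count_list u 0) (count_list u 1) (count_list u 2)"
  by (simp add: foldl_move pt_def)

lemma count_list_replicate: "count_list (replicate n x) y = (if x = y then n else 0)"
  by (induction n) auto


section \<open>The maximal tiling\<close>

lemma maximal_tiling_sorted:
  assumes "sorted w"
  shows "maximal_tiling w = {}"
proof -
  have "\<not> (\<exists>i. descent w i)"
    using assms by (auto simp: descent_def sorted_iff_nth_Suc not_less)
  then show ?thesis by (subst maximal_tiling.simps) (simp only: if_False)
qed

text \<open>As \<open>u @ [a]\<close> is sorted, there is no earlier descent, so the recursion is
  forced to swap exactly here.\<close>

lemma maximal_tiling_swap:
  assumes "sorted (u @ [a])" "b < a"
  shows "maximal_tiling (u @ a # b # v) =
    insert (Tile (foldl move (0, 0) u) a b) (maximal_tiling (u @ b # a # v))"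
proof -
  let ?w = "u @ a # b # v"
  have d: "descent ?w (length u)"
    using assms(2) by (simp add: descent_def nth_append)
  have "length u \<le> i" if "descent ?w i" for i
  proof (rule ccontr)
    assume "\<not> length u \<le> i"
    then have i: "i < length u" by simp
    have "(u @ [a]) ! i \<le> (u @ [a]) ! Suc i"
      using assms(1) i by (simp add: sorted_iff_nth_Suc)
    moreover have "(u @ [a]) ! i = ?w ! i" "(u @ [a]) ! Suc i = ?w ! Suc i"
      using i by (auto simp: nth_append not_less less_Suc_eq)
    ultimately show False
      using that by (simp add: descent_def)
  qed
  with d have fd: "first_descent ?w = length u"
    unfolding first_descent_def by (intro Least_equality) auto
  have "swap_at ?w (length u) = u @ b # a # v"
    by (simp add: swap_at_def nth_append list_update_append)
  moreover have "border_vertex ?w (length u) = foldl move (0, 0) u"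
    by (simp add: border_vertex_def)
  ultimately show ?thesis
    using d fd by (subst maximal_tiling.simps) (auto simp: Let_def nth_append)
qed

text \<open>Iterated swaps: \<open>b\<close> walks left through a block of copies of
  \<open>a\<close>. Its swap with copy \<open>i\<close> (counted from 0) happens behind
  \<open>u\<close> and \<open>i\<close> copies, which fixes the corner of the tile.\<close>

lemma maximal_tiling_pass:
  assumes "sorted (u @ replicate c a)" "b < a"
  shows "maximal_tiling (u @ replicate c a @ b # v) =
    (\<lambda>i. Tile (foldl move (0, 0) (u @ replicate i a)) a b) ` {..<c} \<union>
    maximal_tiling (u @ b # replicate c a @ v)"
  using assms(1)
proof (induction c arbitrary: v)
  case (Suc c)
  have s: "sorted ((u @ replicate c a) @ [a])"
    using Suc.prems by (simp add: replicate_append_same flip: replicate_Suc)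
  have "maximal_tiling (u @ replicate (Suc c) a @ b # v) =
      maximal_tiling ((u @ replicate c a) @ a # b # v)"
    by (simp add: replicate_app_Cons_same)
  also have "\<dots> = insert (Tile (foldl move (0, 0) (u @ replicate c a)) a b)
      (maximal_tiling (u @ replicate c a @ b # a # v))"
    by (subst maximal_tiling_swap[OF s assms(2)]) simp
  also have "maximal_tiling (u @ replicate c a @ b # a # v) =
      (\<lambda>i. Tile (foldl move (0, 0) (u @ replicate i a)) a b) ` {..<c} \<union>
      maximal_tiling (u @ b # replicate c a @ a # v)"
    using s by (intro Suc.IH) (simp add: sorted_append)
  also have "u @ b # replicate c a @ a # v = u @ b # replicate (Suc c) a @ v"
    by (simp add: replicate_app_Cons_same)
  finally show ?case by (auto simp: lessThan_Suc)
qed simp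

locale border_word =
  fixes w :: "nat list"
  assumes letters: "set w \<subseteq> {0, 1, 2}"
begin

definition inversions :: "(nat \<times> nat) set" where
  "inversions = {(i, j). i < j \<and> j < length w \<and> w ! j < w ! i}"

text \<open>
  Swapping first descents is insertion sort: letter \<open>j\<close> is moved to the left through the sorted list of
  the letters before it. Hence the tile of \<open>(i, j)\<close> sits where letter \<open>i\<close> starts in the stably sorted
  prefix of length \<open>j\<close>.
\<close>

definition cell :: "nat \<times> nat \<Rightarrow> tile" where
  "cell = (\<lambda>(i, j). Tile
    (if w ! i = 2 then pt (cnt w 0 j) (cnt w 1 j) (cnt w 2 i) else pt (cnt w 0 j) (cnt w 1 i) 0)
    (w ! i) (w ! j))"

lemma letter_cases:
  assumes "k < length w"
  obtains "w ! k = 0" | "w ! k = 1" | "w ! k = 2"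
proof -
  have "w ! k \<in> {0, 1, 2}"
    using letters nth_mem[OF assms] by (rule subsetD)
  with that show ?thesis by auto
qed

definition sorted_prefix :: "nat \<Rightarrow> nat list" where
  "sorted_prefix j = replicate (cnt w 0 j) 0 @ replicate (cnt w 1 j) 1 @ replicate (cnt w 2 j) 2"

text \<open>One round of insertion: letter \<open>j\<close> passes the block of 2s and then the
  block of 1s, as far as it is smaller, and creates one tile per letter passed.\<close>

lemma maximal_tiling_insert:
  assumes j: "j < length w"
  shows "maximal_tiling (sorted_prefix j @ drop j w) =
    cell ` {(i, j') \<in> inversions. j' = j} \<union> maximal_tiling (sorted_prefix (Suc j) @ drop (Suc j) w)"
proof -
  let ?n = "\<lambda>d. cnt w d j"
  let ?Z = "replicate (?n 0) (0::nat)" and ?O = "replicate (?n 1) (1::nat)"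
    and ?T = "replicate (?n 2) (2::nat)" and ?v = "drop (Suc j) w"
  let ?two = "\<lambda>i. Tile (pt (?n 0) (?n 1) i) 2 (w ! j)"
  let ?one = "\<lambda>i. Tile (pt (?n 0) i 0) 1 (w ! j)"
  have w: "sorted_prefix j @ drop j w = ?Z @ ?O @ ?T @ w ! j # ?v"
    using j by (simp add: sorted_prefix_def Cons_nth_drop_Suc)
  have f2: "foldl move (0, 0) ((?Z @ ?O) @ replicate i 2) = pt (?n 0) (?n 1) i" for i
    by (subst foldl_move_pt) (auto simp: count_list_replicate)
  have f1: "foldl move (0, 0) (?Z @ replicate i 1) = pt (?n 0) i 0" for i
    by (subst foldl_move_pt) (auto simp: count_list_replicate)
  \<comment> \<open>The copy of \<open>d\<close> with index \<open>cnt w d i\<close> is letter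
    \<open>i\<close> of the word, so the tiles of a block are cells of pairs
    \<open>(i, j)\<close>.\<close>
  have image: "h ` {..<?n d} = cell ` {(i, j'). j' = j \<and> i < j \<and> w ! i = d}"
    if "\<And>i. w ! i = d \<Longrightarrow> h (cnt w d i) = cell (i, j)" for h d
  proof -
    have "h ` {..<?n d} = h ` cnt w d ` {i. i < j \<and> w ! i = d}"
      using j by (simp add: cnt_image)
    also have "\<dots> = cell ` (\<lambda>i. (i, j)) ` {i. i < j \<and> w ! i = d}"
      unfolding image_image using that by (intro image_cong) auto
    also have "(\<lambda>i. (i, j)) ` {i. i < j \<and> w ! i = d} = {(i, j'). j' = j \<and> i < j \<and> w ! i = d}"
      by auto
    finally show ?thesis .
  qed
  have two: "?two ` {..<?n 2} = cell ` {(i, j'). j' = j \<and> i < j \<and> w ! i = 2}"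
    by (rule image) (simp add: cell_def)
  have one: "?one ` {..<?n 1} = cell ` {(i, j'). j' = j \<and> i < j \<and> w ! i = 1}"
    by (rule image) (simp add: cell_def)
  have pass2: "maximal_tiling (?Z @ ?O @ ?T @ w ! j # ?v) =
      ?two ` {..<?n 2} \<union> maximal_tiling (?Z @ ?O @ w ! j # ?T @ ?v)" if "w ! j < 2"
    using maximal_tiling_pass[of "?Z @ ?O" "?n 2" 2 "w ! j" ?v] that
    unfolding f2 by (simp add: sorted_append)
  have pass1: "maximal_tiling (?Z @ ?O @ w ! j # ?T @ ?v) =
      ?one ` {..<?n 1} \<union> maximal_tiling (?Z @ w ! j # ?O @ ?T @ ?v)" if "w ! j < 1"
    using maximal_tiling_pass[of "?Z" "?n 1" 1 "w ! j" "?T @ ?v"] that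
    unfolding f1 by (simp add: sorted_append)
  have range: "w ! i = 0 \<or> w ! i = 1 \<or> w ! i = 2" if "i < j" for i
    by (rule letter_cases[of i]) (use that j in auto)
  from j show ?thesis
  proof (cases rule: letter_cases)
    case 1
    have "w ! j < w ! i \<longleftrightarrow> w ! i = 1 \<or> w ! i = 2" if "i < j" for i
      using range[OF that] 1 by auto
    then have "{(i, j') \<in> inversions. j' = j} =
        {(i, j'). j' = j \<and> i < j \<and> w ! i = 1} \<union> {(i, j'). j' = j \<and> i < j \<and> w ! i = 2}"
      using j by (auto simp: inversions_def)
    moreover have "sorted_prefix (Suc j) = ?Z @ 0 # ?O @ ?T"
      using 1 j by (simp add: sorted_prefix_def cnt_Suc replicate_app_Cons_same)
    ultimately show ?thesis
      unfolding w using pass2 pass1 two one 1 by (simp add: image_Un Un_ac)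
  next
    case 2
    have "w ! j < w ! i \<longleftrightarrow> w ! i = 2" if "i < j" for i
      using range[OF that] 2 by auto
    then have "{(i, j') \<in> inversions. j' = j} = {(i, j'). j' = j \<and> i < j \<and> w ! i = 2}"
      using j by (auto simp: inversions_def)
    moreover have "sorted_prefix (Suc j) = ?Z @ ?O @ 1 # ?T"
      using 2 j by (simp add: sorted_prefix_def cnt_Suc replicate_app_Cons_same)
    ultimately show ?thesis
      unfolding w using pass2 two 2 by simp
  next
    case 3
    have "\<not> w ! j < w ! i" if "i < j" for i
      using range[OF that] 3 by auto
    then have none: "{(i, j') \<in> inversions. j' = j} = {}"
      by (auto simp: inversions_def)
    moreover have "sorted_prefix (Suc j) = ?Z @ ?O @ ?T @ [2]"
      using 3 j by (simp add: sorted_prefix_def cnt_Suc replicate_append_same)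
    ultimately show ?thesis
      unfolding w none using 3 by simp
  qed
qed

lemma maximal_tiling_cells: "maximal_tiling w = cell ` inversions"
proof -
  \<comment> \<open>Downward induction: at \<open>j = length w\<close> the word is sorted and
    untiled, each step down undoes one insertion, and \<open>j = 0\<close> gives back
    \<open>w\<close>.\<close>
  have "maximal_tiling (sorted_prefix j @ drop j w) = cell ` {(i, k) \<in> inversions. j \<le> k}"
    if "j \<le> length w" for j
    using that
  proof (induction rule: inc_induct)
    case base
    have "{(i, k) \<in> inversions. length w \<le> k} = {}"
      by (auto simp: inversions_def)
    then show ?case
      by (simp add: maximal_tiling_sorted sorted_prefix_def sorted_append)
  next
    case (step j)
    have "{(i, k) \<in> inversions. j \<le> k} =
        {(i, k) \<in> inversions. k = j} \<union> {(i, k) \<in> inversions. Suc j \<le> k}"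
      by auto
    then show ?case
      using step by (simp only: maximal_tiling_insert image_Un)
  qed
  from this[of 0] show ?thesis by (simp add: sorted_prefix_def)
qed


section \<open>Strips\<close>

text \<open>
  Since \<open>pt\<close> has the kernel spanned by \<open>(1, -1, 1)\<close>, a point does not determine its step counts in
  general. It does so among the vertices of the paths of sorted prefixes, and these contain all
  vertices of the tiling.
\<close>

definition vertices :: "(nat \<times> nat \<times> nat) set" where
  "vertices = {(a, b, c). \<exists>j \<le> length w. a \<le> cnt w 0 j \<and> b \<le> cnt w 1 j \<and> c \<le> cnt w 2 j \<and>
    (0 < b \<longrightarrow> a = cnt w 0 j) \<and> (0 < c \<longrightarrow> a = cnt w 0 j \<and> b = cnt w 1 j)}"

text \<open>Two representations of a point differ by a multiple of \<open>(1, -1, 1)\<close>, so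
  \<open>b < b'\<close> forces \<open>a > a'\<close> and \<open>c > c'\<close>. Then
  \<open>c\<close> and \<open>b'\<close> are positive, which pins \<open>a\<close>, \<open>b\<close>
  and \<open>a'\<close> to full prefix counts and makes the second prefix the longer one, against
  \<open>a > a'\<close>.\<close>

lemma vertices_pt_aux:
  assumes "(a, b, c) \<in> vertices" "(a', b', c') \<in> vertices" "pt a b c = pt a' b' c'"
  shows "\<not> b < b'"
proof
  assume bb: "b < b'"
  have s: "a + b = a' + b'" "b + c = b' + c'"
    using assms(3) by (auto simp: pt_def)
  obtain j where j: "0 < c \<longrightarrow> a = cnt w 0 j \<and> b = cnt w 1 j"
    using assms(1) by (auto simp: vertices_def)
  obtain j' where j': "b' \<le> cnt w 1 j'" "0 < b' \<longrightarrow> a' = cnt w 0 j'"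
    using assms(2) by (auto simp: vertices_def)
  have "cnt w 1 j < cnt w 1 j'"
    using j j' s bb by linarith
  then have "j \<le> j'"
    using cnt_mono[of j' j w 1] by linarith
  then have "cnt w 0 j \<le> cnt w 0 j'"
    by (rule cnt_mono)
  then show False
    using j j' s bb by linarith
qed

lemma vertices_pt_inj:
  assumes "(a, b, c) \<in> vertices" "(a', b', c') \<in> vertices" "pt a b c = pt a' b' c'"
  shows "a = a'" "b = b'" "c = c'"
proof -
  have "b = b'"
    using vertices_pt_aux[OF assms] vertices_pt_aux[OF assms(2,1) assms(3)[symmetric]] by simp
  then show "a = a'" "b = b'" "c = c'"
    using assms(3) by (auto simp: pt_def)
qed

text \<open>
  Swaps never exchange equal letters, so an edge of direction \<open>d\<close> belongs to strip \<open>k\<close> iff as many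
  \<open>d\<close>-steps precede it as precede position \<open>k\<close> in the word.
\<close>

definition edges :: "nat \<Rightarrow> edge set" where
  "edges k = {(pt a b c, w ! k) |a b c. (a, b, c) \<in> vertices \<and>
    (if w ! k = 0 then a else if w ! k = 1 then b else c) = cnt w (w ! k) k}"

text \<open>On \<open>vertices\<close> a point fixes its step counts, so a common edge forces equal
  directions and equally many earlier letters of that direction; distinct occurrences have distinct
  counts.\<close>

lemma edges_unique:
  assumes "e \<in> edges k" "e \<in> edges k'" "k < length w" "k' < length w"
  shows "k = k'"
proof -
  obtain a b c where e: "e = (pt a b c, w ! k)" "(a, b, c) \<in> vertices"
    "(if w ! k = 0 then a else if w ! k = 1 then b else c) = cnt w (w ! k) k"
    using assms(1) unfolding edges_def by auto
  obtain a' b' c' where e': "e = (pt a' b' c', w ! k')" "(a', b', c') \<in> vertices"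
    "(if w ! k' = 0 then a' else if w ! k' = 1 then b' else c') = cnt w (w ! k') k'"
    using assms(2) unfolding edges_def by auto
  have "w ! k = w ! k'" "pt a b c = pt a' b' c'"
    using e(1) e'(1) by auto
  then have "cnt w (w ! k) k = cnt w (w ! k) k'"
    using vertices_pt_inj[OF e(2) e'(2)] e(3) e'(3) by (auto split: if_splits)
  with \<open>w ! k = w ! k'\<close> show ?thesis
    using cnt_less[of k k' w "w ! k"] cnt_less[of k' k w "w ! k"] assms(3,4)
    by (cases k k' rule: linorder_cases) auto
qed

lemma border_vertex_pt: "border_vertex w k = pt (cnt w 0 k) (cnt w 1 k) (cnt w 2 k)"
proof -
  have "set (take k w) \<subseteq> {0, 1, 2}"
    using set_take_subset letters by (rule subset_trans)
  then show ?thesis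
    by (simp add: border_vertex_def foldl_move_pt cnt_def)
qed

lemma start_edges:
  assumes "k < length w"
  shows "(border_vertex w k, w ! k) \<in> edges k"
proof -
  have "(cnt w 0 k, cnt w 1 k, cnt w 2 k) \<in> vertices"
    using assms by (auto simp: vertices_def intro!: exI[of _ k])
  with assms show ?thesis
    unfolding edges_def border_vertex_pt by (cases rule: letter_cases) auto
qed

lemma move_pt:
  "move (pt a b c) 0 = pt (Suc a) b c"
  "move (pt a b c) (Suc 0) = pt a (Suc b) c"
  "move (pt a b c) 2 = pt a b (Suc c)"
  by (auto simp: pt_def)

lemma inversion_cases:
  assumes "(i, j) \<in> inversions"
  obtains "i < j" "j < length w" "w ! i = 2" "w ! j = 1"
  | "i < j" "j < length w" "w ! i = 2" "w ! j = 0"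
  | "i < j" "j < length w" "w ! i = 1" "w ! j = 0"
proof -
  have l: "i < j" "j < length w" "w ! j < w ! i" "i < length w"
    using assms by (auto simp: inversions_def)
  have "w ! i = 0 \<or> w ! i = 1 \<or> w ! i = 2"
    using l(4) by (cases rule: letter_cases) simp_all
  moreover have "w ! j = 0 \<or> w ! j = 1 \<or> w ! j = 2"
    using l(2) by (cases rule: letter_cases) simp_all
  ultimately show ?thesis
    using that l(1-3) by auto
qed

lemma inversion_letters:
  assumes "(i, j) \<in> inversions"
  shows "i < j" "i < length w" "j < length w" "w ! j < w ! i" "w ! i = 1 \<or> w ! i = 2"
    "w ! j = 0 \<or> w ! j = 1"
  using assms by (cases rule: inversion_cases; simp)+

lemma opposite_sides_cell:
  "opposite_sides (cell (i, j)) =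
    (let p = corner (cell (i, j)) in
      {((p, w ! i), (move p (w ! j), w ! i)), ((move p (w ! j), w ! i), (p, w ! i)),
       ((p, w ! j), (move p (w ! i), w ! j)), ((move p (w ! i), w ! j), (p, w ! j))})"
  by (simp add: cell_def Let_def)

lemma cell_edges:
  assumes "(i, j) \<in> inversions"
  shows "(corner (cell (i, j)), w ! i) \<in> edges i"
    "(move (corner (cell (i, j))) (w ! j), w ! i) \<in> edges i"
    "(corner (cell (i, j)), w ! j) \<in> edges j"
    "(move (corner (cell (i, j))) (w ! i), w ! j) \<in> edges j"
proof -
  define p where "p = corner (cell (i, j))"
  have "(p, w ! i) \<in> edges i \<and> (move p (w ! j), w ! i) \<in> edges i \<and>
    (p, w ! j) \<in> edges j \<and> (move p (w ! i), w ! j) \<in> edges j"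
    using assms
  proof (cases rule: inversion_cases)
    case 1
    then have p: "p = pt (cnt w 0 j) (cnt w 1 j) (cnt w 2 i)"
      by (simp add: p_def cell_def)
    have 2: "cnt w 2 i < cnt w 2 j" using 1 by (intro cnt_less) auto
    have "(cnt w 0 j, cnt w 1 j, cnt w 2 i) \<in> vertices"
      "(cnt w 0 j, cnt w 1 j, Suc (cnt w 2 i)) \<in> vertices"
      using 1 2 by (auto simp: vertices_def intro!: exI[of _ j])
    \<comment> \<open>This vertex lies beyond the inserted letter \<open>j\<close>, hence on the
      path of the prefix of length \<open>Suc j\<close> instead of \<open>j\<close>.\<close>
    moreover have "(cnt w 0 j, Suc (cnt w 1 j), cnt w 2 i) \<in> vertices"
      using 1 2 by (auto simp: vertices_def cnt_Suc intro!: exI[of _ "Suc j"])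
    ultimately show ?thesis
      using 1 unfolding p edges_def by (auto simp: move_pt simp del: move.simps)
  next
    case 2
    then have p: "p = pt (cnt w 0 j) (cnt w 1 j) (cnt w 2 i)"
      by (simp add: p_def cell_def)
    have 3: "cnt w 2 i < cnt w 2 j" using 2 by (intro cnt_less) auto
    have "(cnt w 0 j, cnt w 1 j, cnt w 2 i) \<in> vertices"
      "(cnt w 0 j, cnt w 1 j, Suc (cnt w 2 i)) \<in> vertices"
      using 2 3 by (auto simp: vertices_def intro!: exI[of _ j])
    moreover have "(Suc (cnt w 0 j), cnt w 1 j, cnt w 2 i) \<in> vertices"
      using 2 3 by (auto simp: vertices_def cnt_Suc intro!: exI[of _ "Suc j"])
    ultimately show ?thesis
      using 2 unfolding p edges_def by (auto simp: move_pt simp del: move.simps)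
  next
    case 3
    then have p: "p = pt (cnt w 0 j) (cnt w 1 i) 0"
      by (simp add: p_def cell_def)
    have 4: "cnt w 1 i < cnt w 1 j" using 3 by (intro cnt_less) auto
    have "(cnt w 0 j, cnt w 1 i, 0) \<in> vertices" "(cnt w 0 j, Suc (cnt w 1 i), 0) \<in> vertices"
      using 3 4 by (auto simp: vertices_def intro!: exI[of _ j])
    moreover have "(Suc (cnt w 0 j), cnt w 1 i, 0) \<in> vertices"
      using 3 4 by (auto simp: vertices_def cnt_Suc intro!: exI[of _ "Suc j"])
    ultimately show ?thesis
      using 3 unfolding p edges_def by (auto simp: move_pt simp del: move.simps)
  qed
  then show "(corner (cell (i, j)), w ! i) \<in> edges i"
    "(move (corner (cell (i, j))) (w ! j), w ! i) \<in> edges i"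
    "(corner (cell (i, j)), w ! j) \<in> edges j"
    "(move (corner (cell (i, j))) (w ! i), w ! j) \<in> edges j"
    unfolding p_def by blast+
qed

lemma opposite_sides_edges:
  assumes "(i, j) \<in> inversions" "(e, e') \<in> opposite_sides (cell (i, j))"
  shows "e \<in> edges i \<and> e' \<in> edges i \<or> e \<in> edges j \<and> e' \<in> edges j"
  using assms(2) cell_edges[OF assms(1)]
  unfolding opposite_sides_cell Let_def by (elim insertE emptyE) (simp_all del: move.simps)

text \<open>The sides of a tile are edges of strips \<open>i\<close> and \<open>j\<close>, and an
  edge belongs to a single strip, so the tile determines its inversion.\<close>

lemma inj_on_cell: "inj_on cell inversions"
proof (rule inj_onI)
  fix x y
  assume x: "x \<in> inversions" and y: "y \<in> inversions" and eq: "cell x = cell y"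
  obtain i j i' j' where [simp]: "x = (i, j)" "y = (i', j')"
    by (metis surj_pair)
  have ww: "w ! i = w ! i'" "w ! j = w ! j'"
    using eq by (auto simp: cell_def)
  have "i = i'"
    using cell_edges(1)[of i j] cell_edges(1)[of i' j'] x y eq ww
    by (intro edges_unique[of "(corner (cell x), w ! i)"]) (auto simp: inversions_def)
  moreover have "j = j'"
    using cell_edges(3)[of i j] cell_edges(3)[of i' j'] x y eq ww
    by (intro edges_unique[of "(corner (cell x), w ! j)"]) (auto simp: inversions_def)
  ultimately show "x = y" by simp
qed

text \<open>\<open>edges k\<close> is closed under crossing a tile: opposite sides lie in the edge
  set of the same strip, and these sets are disjoint by \<open>edges_unique\<close>.\<close>

lemma strip_edges_imp_edges:
  assumes "k < length w" "e \<in> strip_edges w k"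
  shows "e \<in> edges k"
  using assms(2)
proof induction
  case start
  show ?case using assms(1) by (rule start_edges)
next
  case (cross e t e')
  obtain i j where ij: "(i, j) \<in> inversions" "t = cell (i, j)"
    using cross(2) unfolding maximal_tiling_cells by auto
  have "i < length w" "j < length w"
    using ij(1) by (auto simp: inversions_def)
  then show ?case
    using opposite_sides_edges[OF ij(1)] cross(3,4) ij(2) edges_unique[OF cross(4) _ assms(1)]
    by blast
qed

lemma opposite_sides_strip_edges:
  assumes "(i, j) \<in> inversions"
  shows "(corner (cell (i, j)), w ! i) \<in> strip_edges w k \<longleftrightarrow>
      (move (corner (cell (i, j))) (w ! j), w ! i) \<in> strip_edges w k"
    and "(corner (cell (i, j)), w ! j) \<in> strip_edges w k \<longleftrightarrow>
      (move (corner (cell (i, j))) (w ! i), w ! j) \<in> strip_edges w k"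
proof -
  have t: "cell (i, j) \<in> maximal_tiling w"
    using assms by (simp add: maximal_tiling_cells)
  show "(corner (cell (i, j)), w ! i) \<in> strip_edges w k \<longleftrightarrow>
      (move (corner (cell (i, j))) (w ! j), w ! i) \<in> strip_edges w k"
    by (rule iffI; erule strip_edges.cross[OF _ t]) (simp_all add: cell_def)
  show "(corner (cell (i, j)), w ! j) \<in> strip_edges w k \<longleftrightarrow>
      (move (corner (cell (i, j))) (w ! i), w ! j) \<in> strip_edges w k"
    by (rule iffI; erule strip_edges.cross[OF _ t]) (simp_all add: cell_def)
qed

section \<open>Walks along the strips\<close>

lemma start_pt: "(pt (cnt w 0 k) (cnt w 1 k) (cnt w 2 k), w ! k) \<in> strip_edges w k"
  using strip_edges.start[of w k] by (simp only: border_vertex_pt)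

text \<open>Walking west, row \<open>i\<close> crosses the later letters in word order. A letter 2
  gives no tile and leaves the first two counts alone, so the edge stays the same.\<close>

lemma row_reach:
  assumes "w ! i = 2" "i \<le> j" "j \<le> length w"
  shows "(pt (cnt w 0 j) (cnt w 1 j) (cnt w 2 i), 2) \<in> strip_edges w i"
  using assms(2,3)
proof (induction j rule: dec_induct)
  case base
  show ?case using start_pt[of i] assms(1) by simp
next
  case (step j)
  show ?case
  proof (cases "w ! j = 2")
    case True
    then show ?thesis using step by (simp add: cnt_Suc)
  next
    case False
    have "j < length w" "i \<noteq> j"
      using step.prems assms(1) False by auto
    then have j: "w ! j = 0 \<or> w ! j = 1"
      using False by (cases rule: letter_cases) auto
    then have inv: "(i, j) \<in> inversions"
      using step.hyps \<open>j < length w\<close> \<open>i \<noteq> j\<close> assms(1) by (auto simp: inversions_def)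
    show ?thesis using j
      using opposite_sides_strip_edges(1)[OF inv, of i] assms(1) step
      by (auto simp: cell_def cnt_Suc move_pt simp del: move.simps)
  qed
qed

text \<open>From its border edge a column or diagonal strip first goes north through the rows that
  start before it, the nearest one first.\<close>

lemma upward_reach:
  assumes "w ! k < 2" "i \<le> k" "k < length w"
  shows "(pt (cnt w 0 k) (cnt w 1 k) (cnt w 2 i), w ! k) \<in> strip_edges w k"
  using assms(2)
proof (induction i rule: inc_induct)
  case base
  show ?case by (rule start_pt)
next
  case (step i)
  show ?case
  proof (cases "w ! i = 2")
    case True
    then have "(i, k) \<in> inversions"
      using step assms by (simp add: inversions_def)
    then show ?thesis
      using opposite_sides_strip_edges(2)[of i k k] step True assms
      by (auto simp: cell_def cnt_Suc move_pt simp del: move.simps)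
  next
    case False
    then show ?thesis using step assms by (simp add: cnt_Suc)
  qed
qed

text \<open>Above all its rows (\<open>i = 0\<close> in \<open>upward_reach\<close>) a column goes
  on north through the diagonal strips that start before it.\<close>

lemma column_reach:
  assumes "w ! k = 0" "i \<le> k" "k < length w"
  shows "(pt (cnt w 0 k) (cnt w 1 i) 0, 0) \<in> strip_edges w k"
  using assms(2)
proof (induction i rule: inc_induct)
  case base
  show ?case using upward_reach[of k 0] assms by simp
next
  case (step i)
  show ?case
  proof (cases "w ! i = 1")
    case True
    then have "(i, k) \<in> inversions"
      using step assms by (simp add: inversions_def)
    then show ?thesis
      using opposite_sides_strip_edges(2)[of i k k] step True assms
      by (auto simp: cell_def cnt_Suc move_pt simp del: move.simps)
  next
    case False
    then show ?thesis using step assms by (simp add: cnt_Suc)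
  qed
qed

text \<open>Above all its rows a diagonal strip goes on through the columns that start after
  it.\<close>

lemma diagonal_reach:
  assumes "w ! k = 1" "k \<le> j" "j \<le> length w" "k < length w"
  shows "(pt (cnt w 0 j) (cnt w 1 k) 0, 1) \<in> strip_edges w k"
  using assms(2,3)
proof (induction j rule: dec_induct)
  case base
  show ?case using upward_reach[of k 0] assms by simp
next
  case (step j)
  show ?case
  proof (cases "w ! j = 0")
    case True
    then have "(k, j) \<in> inversions"
      using step assms by (auto simp: inversions_def nat_less_le)
    then show ?thesis
      using opposite_sides_strip_edges(1)[of k j k] step True assms
      by (auto simp: cell_def cnt_Suc move_pt simp del: move.simps)
  next
    case False
    then show ?thesis using step assms by (simp add: cnt_Suc)
  qed
qed

lemma cell_reach:
  assumes "(i, j) \<in> inversions"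
  shows "(corner (cell (i, j)), w ! i) \<in> strip_edges w i"
    and "(corner (cell (i, j)), w ! j) \<in> strip_edges w j"
proof -
  have "(corner (cell (i, j)), w ! i) \<in> strip_edges w i \<and>
    (corner (cell (i, j)), w ! j) \<in> strip_edges w j"
    using assms
  proof (cases rule: inversion_cases)
    case 1
    then show ?thesis
      using row_reach[of i j] upward_reach[of j i] by (simp add: cell_def)
  next
    case 2
    then show ?thesis
      using row_reach[of i j] upward_reach[of j i] by (simp add: cell_def)
  next
    case 3
    then show ?thesis
      using diagonal_reach[of i j] column_reach[of j i] by (simp add: cell_def)
  qed
  then show "(corner (cell (i, j)), w ! i) \<in> strip_edges w i"
    "(corner (cell (i, j)), w ! j) \<in> strip_edges w j"
    by simp_all
qed

text \<open>The invariant \<open>edges\<close> excludes foreign tiles; the walks reach all the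
  others.\<close>

lemma strip_cells:
  assumes "k < length w"
  shows "strip w k = cell ` {(i, j) \<in> inversions. k = i \<or> k = j}"
proof (rule subset_antisym; rule subsetI)
  fix t
  assume "t \<in> strip w k"
  then have t: "t \<in> maximal_tiling w"
    and ex: "\<exists>e \<in> strip_edges w k. e \<in> Domain (opposite_sides t)"
    by (simp_all only: strip_def mem_Collect_eq)
  obtain e where e: "e \<in> strip_edges w k" and dom: "e \<in> Domain (opposite_sides t)"
    using ex by (rule bexE)
  obtain i j where ij: "(i, j) \<in> inversions" "t = cell (i, j)"
    using t unfolding maximal_tiling_cells by auto
  obtain e' where "(e, e') \<in> opposite_sides (cell (i, j))"
    using dom unfolding ij(2) by (rule DomainE)
  then have "e \<in> edges i \<or> e \<in> edges j"
    using opposite_sides_edges[OF ij(1)] by blast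
  moreover have "e \<in> edges k"
    using assms e by (rule strip_edges_imp_edges)
  ultimately have "k = i \<or> k = j"
    using edges_unique[of e k i] edges_unique[of e k j] assms inversion_letters(2,3)[OF ij(1)]
    by blast
  then show "t \<in> cell ` {(i, j) \<in> inversions. k = i \<or> k = j}"
    using ij by auto
next
  fix t
  assume "t \<in> cell ` {(i, j) \<in> inversions. k = i \<or> k = j}"
  then obtain i j where ij: "(i, j) \<in> inversions" "t = cell (i, j)" "k = i \<or> k = j"
    by auto
  have "(corner t, w ! i) \<in> Domain (opposite_sides t)" "(corner t, w ! j) \<in> Domain (opposite_sides t)"
    unfolding ij(2) by (simp_all add: opposite_sides_cell Let_def Domain_insert del: move.simps)
  then have "\<exists>e \<in> strip_edges w k. e \<in> Domain (opposite_sides t)"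
    using cell_reach[OF ij(1)] ij(2,3) by blast
  then show "t \<in> strip w k"
    using ij(1,2) by (simp add: strip_def maximal_tiling_cells)
qed

lemma cell_in_strip:
  assumes "(i, j) \<in> inversions" "k < length w"
  shows "cell (i, j) \<in> strip w k \<longleftrightarrow> k = i \<or> k = j"
proof -
  have "cell (i, j) \<in> strip w k \<longleftrightarrow> (i, j) \<in> {(i, j) \<in> inversions. k = i \<or> k = j}"
    unfolding strip_cells[OF assms(2)]
    by (rule inj_on_image_mem_iff[OF inj_on_cell assms(1)]) auto
  then show ?thesis using assms by simp
qed

text \<open>The tile of \<open>(i, j)\<close> in row \<open>i\<close> has abscissa
  \<open>- (cnt w 0 j + cnt w 1 j)\<close>, which falls strictly at each strip crossed, so label
  order is the order from east to west.\<close>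

lemma row_west_iff:
  assumes "(i, j) \<in> inversions" "(i', j') \<in> inversions"
  shows "(\<exists>k. is_row w k \<and> cell (i, j) \<in> strip w k \<and> cell (i', j') \<in> strip w k
      \<and> fst (corner (cell (i', j'))) < fst (corner (cell (i, j)))) \<longleftrightarrow>
    w ! i = 2 \<and> i = i' \<and> j < j'"
proof -
  have west: "fst (corner (cell (i, j'))) < fst (corner (cell (i, j))) \<longleftrightarrow> j < j'"
    if "w ! i = 2" "(i, j) \<in> inversions" "(i, j') \<in> inversions" for j j'
  proof -
    have less: "cnt w 0 j + cnt w 1 j < cnt w 0 j' + cnt w 1 j'"
      if "j < j'" "(i, j) \<in> inversions" "(i, j') \<in> inversions" for j j'
      using that(2)
    proof (cases rule: inversion_cases)
      case 1
      then show ?thesis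
        using cnt_less[of j j' w 1] cnt_mono[of j j' w 0] that by (auto simp: inversions_def)
    qed (use cnt_less[of j j' w 0] cnt_mono[of j j' w 1] that in \<open>auto simp: inversions_def\<close>)
    show ?thesis
      using that less[of j j'] less[of j' j] by (cases j j' rule: linorder_cases) (auto simp: cell_def pt_def)
  qed
  have "i < length w" "j < length w" "i' < length w" "j' < length w" "w ! j \<noteq> 2" "w ! j' \<noteq> 2"
    using inversion_letters[OF assms(1)] inversion_letters[OF assms(2)] by auto
  then show ?thesis
    using assms west[of j j'] by (auto simp: is_row_def cell_in_strip)
qed

text \<open>In column \<open>j\<close> a tile with row \<open>i\<close> has ordinate
  \<open>- (cnt w 1 j + cnt w 2 i)\<close>, one with diagonal \<open>i\<close> has
  \<open>- cnt w 1 i\<close>, and then \<open>cnt w 1 i < cnt w 1 j\<close>. So the diagonal tiles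
  lie north of all row tiles, and within one kind the earlier letter lies further north.\<close>

lemma column_north_iff:
  assumes "(i, j) \<in> inversions" "(i', j') \<in> inversions"
  shows "(\<exists>k. is_column w k \<and> cell (i, j) \<in> strip w k \<and> cell (i', j') \<in> strip w k
      \<and> snd (corner (cell (i, j))) < snd (corner (cell (i', j')))) \<longleftrightarrow>
    w ! j = 0 \<and> j = j' \<and> (w ! i' < w ! i \<or> w ! i' = w ! i \<and> i' < i)"
proof -
  have north: "snd (corner (cell (i, j))) < snd (corner (cell (i', j))) \<longleftrightarrow>
      w ! i' < w ! i \<or> w ! i' = w ! i \<and> i' < i"
    if "w ! j = 0" "(i, j) \<in> inversions" "(i', j) \<in> inversions"
  proof -
    have l: "i < j" "i' < j" "j < length w" "i < length w" "i' < length w"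
      using that by (auto simp: inversions_def)
    have v: "w ! i = 1 \<or> w ! i = 2" "w ! i' = 1 \<or> w ! i' = 2"
      using inversion_letters[OF that(2)] inversion_letters[OF that(3)] by blast+
    have 1: "w ! x = 1 \<Longrightarrow> x < j \<Longrightarrow> cnt w 1 x < cnt w 1 j" for x
      using l by (intro cnt_less) auto
    have "i' < i \<longleftrightarrow> cnt w (w ! i) i' < cnt w (w ! i) i" if "w ! i = w ! i'"
      using cnt_less[of i' i w "w ! i"] cnt_mono[of i i' w "w ! i"] that l by fastforce
    then show ?thesis
      using v 1[of i] 1[of i'] l by (auto simp: cell_def pt_def)
  qed
  have "i < length w" "j < length w" "i' < length w" "j' < length w" "w ! i \<noteq> 0" "w ! i' \<noteq> 0"
    using assms by (auto simp: inversions_def)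
  then show ?thesis
    using assms north by (auto simp: is_column_def cell_in_strip)
qed

end


section \<open>Cells addressed by labels\<close>

lemma nth_sorted_rank:
  assumes "finite L" "l \<in> L"
  shows "sorted_list_of_set L ! rank L l = l"
proof -
  let ?xs = "sorted_list_of_set L"
  obtain i where i: "i < length ?xs" "?xs ! i = l"
    using assms by (metis in_set_conv_nth set_sorted_list_of_set)
  have less: "?xs ! a < ?xs ! b \<longleftrightarrow> a < b" if "a < length ?xs" "b < length ?xs" for a b
    using that strict_sorted_list_of_set[of L]
    by (metis linorder_neqE_nat order_less_asym sorted_wrt_nth_less)
  have "{k \<in> L. k < l} = {k \<in> set ?xs. k < l}"
    using assms(1) by simp
  also have "\<dots> = (!) ?xs ` {a. a < length ?xs \<and> ?xs ! a < ?xs ! i}"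
    unfolding i(2) by (auto simp: in_set_conv_nth)
  also have "{a. a < length ?xs \<and> ?xs ! a < ?xs ! i} = {..<i}"
    using less i(1) by auto
  finally have "rank L l = card ((!) ?xs ` {..<i})"
    by (simp add: rank_def)
  also have "\<dots> = i"
    using i(1) by (subst card_image) (auto intro!: inj_onI simp: nth_eq_iff_index_eq)
  finally show ?thesis using i by simp
qed

lemma rank_less_card:
  assumes "finite L" "l \<in> L"
  shows "rank L l < card L"
  unfolding rank_def using assms by (intro psubset_card_mono) auto

lemma rank_less_iff:
  assumes "finite L" "l \<in> L" "l' \<in> L"
  shows "rank L l < rank L l' \<longleftrightarrow> l < l'"
proof -
  have *: "rank L a < rank L b" if "a < b" "a \<in> L" "b \<in> L" for a b
    unfolding rank_def using assms(1) that by (intro psubset_card_mono) auto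
  show ?thesis
    using *[of l l'] *[of l' l] assms by (cases l l' rule: linorder_cases) auto
qed

lemma bij_betw_rank:
  assumes "finite L"
  shows "bij_betw (rank L) L {..<card L}"
proof -
  have inj: "inj_on (rank L) L"
    using assms rank_less_iff by (intro linorder_inj_onI) fastforce+
  moreover have "rank L ` L = {..<card L}"
    using inj assms rank_less_card by (intro card_subset_eq) (auto simp: card_image)
  ultimately show ?thesis by (simp add: bij_betw_def)
qed

lemma count_list_rank:
  assumes "finite L" "length w = card L"
  shows "count_list w d = card {l \<in> L. w ! rank L l = d}"
proof -
  have "count_list w d = card {i. i < length w \<and> w ! i = d}"
    by (simp add: count_list_eq_length_filter length_filter_conv_card eq_commute)
  also have "{i. i < length w \<and> w ! i = d} = {i \<in> rank L ` L. w ! i = d}"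
    using bij_betw_imp_surj_on[OF bij_betw_rank[OF assms(1)]] assms(2) by auto
  also have "\<dots> = rank L ` {l \<in> L. w ! rank L l = d}"
    by auto
  also have "card \<dots> = card {l \<in> L. w ! rank L l = d}"
    using bij_betw_rank[OF assms(1)]
    by (intro card_image) (auto simp: bij_betw_def intro: inj_on_subset)
  finally show ?thesis .
qed

section \<open>Directions and arrows as functions of labels\<close>

definition dir :: "labeled_filling \<Rightarrow> nat \<Rightarrow> nat" where
  "dir T l = word T ! rank (labels T) l"

definition label_cell :: "labeled_filling \<Rightarrow> nat \<times> nat \<Rightarrow> tile" where
  "label_cell T = (\<lambda>(i, j). border_word.cell (word T) (rank (labels T) i, rank (labels T) j))"

definition label_inversions :: "labeled_filling \<Rightarrow> (nat \<times> nat) set" where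
  "label_inversions T = {(i, j). i \<in> labels T \<and> j \<in> labels T \<and> i < j \<and> dir T j < dir T i}"

text \<open>Addressing by labels instead of coordinates allows comparing a RAT with its
  restrictions. The default \<open>None\<close> makes the function total, so fillings are compared
  pointwise without side conditions.\<close>

definition arr :: "labeled_filling \<Rightarrow> nat \<Rightarrow> nat \<Rightarrow> arrow option" where
  "arr T i j = (if (i, j) \<in> label_inversions T then filling T (label_cell T (i, j)) else None)"

definition bordered :: "labeled_filling \<Rightarrow> bool" where
  "bordered T \<longleftrightarrow> finite (labels T) \<and> length (word T) = card (labels T) \<and> set (word T) \<subseteq> {0, 1, 2}"

lemma border_word_bordered: "bordered T \<Longrightarrow> border_word (word T)"
  by (simp add: bordered_def border_word_def)

lemma bij_betw_label_inversions:
  assumes "bordered T"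
  shows "bij_betw (\<lambda>(i, j). (rank (labels T) i, rank (labels T) j)) (label_inversions T)
    (border_word.inversions (word T))"
proof -
  interpret border_word "word T" using assms by (rule border_word_bordered)
  let ?L = "labels T"
  let ?f = "\<lambda>(i, j). (rank ?L i, rank ?L j)"
  have fin: "finite ?L" and len: "length (word T) = card ?L"
    using assms by (auto simp: bordered_def)
  have b: "bij_betw (rank ?L) ?L {..<card ?L}"
    using fin by (rule bij_betw_rank)
  have "inj_on ?f (label_inversions T)"
    using bij_betw_imp_inj_on[OF b] by (auto simp: inj_on_def label_inversions_def)
  moreover have "?f ` label_inversions T = inversions"
  proof (rule subset_antisym; rule subsetI)
    fix p assume "p \<in> ?f ` label_inversions T"
    then show "p \<in> inversions"
      using rank_less_iff[OF fin] rank_less_card[OF fin] len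
      by (auto simp: label_inversions_def inversions_def dir_def)
  next
    fix p assume p: "p \<in> inversions"
    obtain i j where ij: "p = (i, j)" by (cases p)
    have "i \<in> rank ?L ` ?L" "j \<in> rank ?L ` ?L"
      using inversion_letters(2,3)[of i j] p ij bij_betw_imp_surj_on[OF b] len by auto
    then obtain a c where ac: "a \<in> ?L" "c \<in> ?L" "i = rank ?L a" "j = rank ?L c"
      by auto
    have "(a, c) \<in> label_inversions T"
      using p rank_less_iff[OF fin ac(1,2)] ac by (auto simp: ij inversions_def label_inversions_def dir_def)
    then show "p \<in> ?f ` label_inversions T"
      using ac ij by force
  qed
  ultimately show ?thesis by (simp add: bij_betw_def)
qed

lemma rank_inversion:
  assumes "bordered T" "(i, j) \<in> label_inversions T"
  shows "(rank (labels T) i, rank (labels T) j) \<in> border_word.inversions (word T)"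
  using bij_betw_apply[OF bij_betw_label_inversions[OF assms(1)] assms(2)] by simp

lemma bij_betw_label_cell:
  assumes "bordered T"
  shows "bij_betw (label_cell T) (label_inversions T) (maximal_tiling (word T))"
proof -
  interpret border_word "word T" using assms by (rule border_word_bordered)
  have "bij_betw cell inversions (maximal_tiling (word T))"
    using inj_on_cell by (simp add: bij_betw_def maximal_tiling_cells)
  then have "bij_betw (cell \<circ> (\<lambda>(i, j). (rank (labels T) i, rank (labels T) j)))
      (label_inversions T) (maximal_tiling (word T))"
    by (rule bij_betw_trans[OF bij_betw_label_inversions[OF assms]])
  moreover have "cell \<circ> (\<lambda>(i, j). (rank (labels T) i, rank (labels T) j)) = label_cell T"
    by (auto simp: label_cell_def fun_eq_iff)
  ultimately show ?thesis by simp
qed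

lemma label_cell_in_strip:
  assumes "bordered T" "(i, j) \<in> label_inversions T" "k \<in> labels T"
  shows "label_cell T (i, j) \<in> strip (word T) (rank (labels T) k) \<longleftrightarrow> k = i \<or> k = j"
proof -
  interpret border_word "word T" using assms(1) by (rule border_word_bordered)
  have fin: "finite (labels T)" and len: "length (word T) = card (labels T)"
    using assms(1) by (auto simp: bordered_def)
  have l: "i \<in> labels T" "j \<in> labels T"
    using assms(2) by (auto simp: label_inversions_def)
  have "rank (labels T) k < length (word T)"
    using rank_less_card[OF fin assms(3)] len by simp
  then have "label_cell T (i, j) \<in> strip (word T) (rank (labels T) k) \<longleftrightarrow>
      rank (labels T) k = rank (labels T) i \<or> rank (labels T) k = rank (labels T) j"
    unfolding label_cell_def prod.case by (rule cell_in_strip[OF rank_inversion[OF assms(1,2)]])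
  also have "\<dots> \<longleftrightarrow> k = i \<or> k = j"
    using bij_betw_imp_inj_on[OF bij_betw_rank[OF fin]] assms(3) l by (simp add: inj_on_eq_iff)
  finally show ?thesis .
qed

lemma strip_label_cells:
  assumes "bordered T" "k \<in> labels T"
  shows "strip (word T) (rank (labels T) k) =
    label_cell T ` {(i, j) \<in> label_inversions T. k = i \<or> k = j}"
proof -
  have sub: "strip (word T) (rank (labels T) k) \<subseteq> label_cell T ` label_inversions T"
    using bij_betw_imp_surj_on[OF bij_betw_label_cell[OF assms(1)]] by (auto simp: strip_def)
  show ?thesis
  proof (rule subset_antisym; rule subsetI)
    fix t assume t: "t \<in> strip (word T) (rank (labels T) k)"
    with sub obtain i j where ij: "(i, j) \<in> label_inversions T" "t = label_cell T (i, j)"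
      by auto
    then show "t \<in> label_cell T ` {(i, j) \<in> label_inversions T. k = i \<or> k = j}"
      using t label_cell_in_strip[OF assms(1) ij(1) assms(2)] by blast
  next
    fix t assume "t \<in> label_cell T ` {(i, j) \<in> label_inversions T. k = i \<or> k = j}"
    then obtain i j where ij: "(i, j) \<in> label_inversions T" "t = label_cell T (i, j)"
      "k = i \<or> k = j"
      by auto
    then show "t \<in> strip (word T) (rank (labels T) k)"
      using label_cell_in_strip[OF assms(1) ij(1) assms(2)] by blast
  qed
qed

text \<open>A tile lies on exactly two strips, so meeting strips \<open>i\<close> and
  \<open>j\<close> identifies its inversion.\<close>

lemma is_cell_iff:
  assumes "bordered T"
  shows "is_cell (labels T) (word T) i j t \<longleftrightarrow>
    (i, j) \<in> label_inversions T \<and> t = label_cell T (i, j)"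
proof
  assume "is_cell (labels T) (word T) i j t"
  then have l: "i \<in> labels T" "j \<in> labels T" "i < j"
    and s: "t \<in> strip (word T) (rank (labels T) i)" "t \<in> strip (word T) (rank (labels T) j)"
    by (auto simp: is_cell_def)
  obtain a b where ab: "(a, b) \<in> label_inversions T" "t = label_cell T (a, b)"
    using s(1) strip_label_cells[OF assms l(1)] by auto
  then have "(i = a \<or> i = b) \<and> (j = a \<or> j = b) \<and> a < b"
    using s label_cell_in_strip[OF assms ab(1)] l by (auto simp: label_inversions_def)
  then have "i = a" "j = b" using l(3) by auto
  with ab show "(i, j) \<in> label_inversions T \<and> t = label_cell T (i, j)" by simp
next
  assume "(i, j) \<in> label_inversions T \<and> t = label_cell T (i, j)"
  then have ij: "(i, j) \<in> label_inversions T" "t = label_cell T (i, j)" by auto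
  then have l: "i \<in> labels T" "j \<in> labels T" "i < j"
    by (auto simp: label_inversions_def)
  show "is_cell (labels T) (word T) i j t"
    using ij l label_cell_in_strip[OF assms ij(1)] by (simp add: is_cell_def)
qed

lemma label_row_west_iff:
  assumes "bordered T" "(i, j) \<in> label_inversions T" "(i', j') \<in> label_inversions T"
  shows "(\<exists>k. is_row (word T) k \<and> label_cell T (i, j) \<in> strip (word T) k \<and>
      label_cell T (i', j') \<in> strip (word T) k \<and>
      fst (corner (label_cell T (i', j'))) < fst (corner (label_cell T (i, j)))) \<longleftrightarrow>
    dir T i = 2 \<and> i = i' \<and> j < j'"
proof -
  interpret border_word "word T" using assms(1) by (rule border_word_bordered)
  have fin: "finite (labels T)" using assms(1) by (simp add: bordered_def)
  have l: "i \<in> labels T" "i' \<in> labels T" "j \<in> labels T" "j' \<in> labels T"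
    using assms(2,3) by (auto simp: label_inversions_def)
  show ?thesis
    unfolding label_cell_def prod.case
      row_west_iff[OF rank_inversion[OF assms(1,2)] rank_inversion[OF assms(1,3)]]
    using rank_less_iff[OF fin l(3,4)] bij_betw_imp_inj_on[OF bij_betw_rank[OF fin]] l
    by (simp add: dir_def inj_on_eq_iff)
qed

lemma label_column_north_iff:
  assumes "bordered T" "(i, j) \<in> label_inversions T" "(i', j') \<in> label_inversions T"
  shows "(\<exists>k. is_column (word T) k \<and> label_cell T (i, j) \<in> strip (word T) k \<and>
      label_cell T (i', j') \<in> strip (word T) k \<and>
      snd (corner (label_cell T (i, j))) < snd (corner (label_cell T (i', j')))) \<longleftrightarrow>
    dir T j = 0 \<and> j = j' \<and> (dir T i' < dir T i \<or> dir T i' = dir T i \<and> i' < i)"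
proof -
  interpret border_word "word T" using assms(1) by (rule border_word_bordered)
  have fin: "finite (labels T)" using assms(1) by (simp add: bordered_def)
  have l: "i \<in> labels T" "i' \<in> labels T" "j \<in> labels T" "j' \<in> labels T"
    using assms(2,3) by (auto simp: label_inversions_def)
  show ?thesis
    unfolding label_cell_def prod.case
      column_north_iff[OF rank_inversion[OF assms(1,2)] rank_inversion[OF assms(1,3)]]
    using rank_less_iff[OF fin l(2,1)] bij_betw_imp_inj_on[OF bij_betw_rank[OF fin]] l
    by (simp add: dir_def inj_on_eq_iff)
qed

lemma ex_strip_label:
  assumes "bordered T"
  shows "(\<exists>k. k < length (word T) \<and> P k) \<longleftrightarrow> (\<exists>l \<in> labels T. P (rank (labels T) l))"
proof -
  have fin: "finite (labels T)" and len: "length (word T) = card (labels T)"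
    using assms by (auto simp: bordered_def)
  have "{..<length (word T)} = rank (labels T) ` labels T"
    using bij_betw_imp_surj_on[OF bij_betw_rank[OF fin]] len by simp
  then have "k < length (word T) \<longleftrightarrow> k \<in> rank (labels T) ` labels T" for k
    by (metis lessThan_iff)
  then show ?thesis by auto
qed

lemma dir_cases:
  assumes "bordered T" "l \<in> labels T"
  shows "dir T l \<in> {0, 1, 2}"
proof -
  have "rank (labels T) l < length (word T)"
    using assms rank_less_card by (auto simp: bordered_def)
  then have "dir T l \<in> set (word T)"
    unfolding dir_def by (rule nth_mem)
  moreover have "set (word T) \<subseteq> {0, 1, 2}"
    using assms(1) by (simp add: bordered_def)
  ultimately show ?thesis by (rule rev_subsetD)
qed

lemma label_inversion_dirs:
  assumes "bordered T" "(i, j) \<in> label_inversions T"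
  shows "dir T i = 1 \<or> dir T i = 2" "dir T j = 0 \<or> dir T j = 1"
  using assms dir_cases[OF assms(1), of i] dir_cases[OF assms(1), of j]
  by (auto simp: label_inversions_def)

lemma label_cell_in_row:
  assumes "bordered T" "(i, j) \<in> label_inversions T"
  shows "(\<exists>k. is_row (word T) k \<and> label_cell T (i, j) \<in> strip (word T) k) \<longleftrightarrow> dir T i = 2"
proof -
  have "(\<exists>k. is_row (word T) k \<and> label_cell T (i, j) \<in> strip (word T) k) \<longleftrightarrow>
      (\<exists>l \<in> labels T. dir T l = 2 \<and> label_cell T (i, j) \<in> strip (word T) (rank (labels T) l))"
    using ex_strip_label[OF assms(1), of "\<lambda>k. word T ! k = 2 \<and> label_cell T (i, j) \<in> strip (word T) k"]
    by (simp add: is_row_def dir_def)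
  also have "\<dots> \<longleftrightarrow> (\<exists>l \<in> labels T. dir T l = 2 \<and> (l = i \<or> l = j))"
    using label_cell_in_strip[OF assms] by blast
  also have "\<dots> \<longleftrightarrow> dir T i = 2"
    using assms(2) label_inversion_dirs[OF assms] by (auto simp: label_inversions_def)
  finally show ?thesis .
qed

lemma label_cell_in_column:
  assumes "bordered T" "(i, j) \<in> label_inversions T"
  shows "(\<exists>k. is_column (word T) k \<and> label_cell T (i, j) \<in> strip (word T) k) \<longleftrightarrow> dir T j = 0"
proof -
  have "(\<exists>k. is_column (word T) k \<and> label_cell T (i, j) \<in> strip (word T) k) \<longleftrightarrow>
      (\<exists>l \<in> labels T. dir T l = 0 \<and> label_cell T (i, j) \<in> strip (word T) (rank (labels T) l))"
    using ex_strip_label[OF assms(1), of "\<lambda>k. word T ! k = 0 \<and> label_cell T (i, j) \<in> strip (word T) k"]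
    by (simp add: is_column_def dir_def)
  also have "\<dots> \<longleftrightarrow> (\<exists>l \<in> labels T. dir T l = 0 \<and> (l = i \<or> l = j))"
    using label_cell_in_strip[OF assms] by blast
  also have "\<dots> \<longleftrightarrow> dir T j = 0"
    using assms(2) label_inversion_dirs[OF assms] by (auto simp: label_inversions_def)
  finally show ?thesis .
qed

text \<open>The RAT axioms with tiles replaced by pairs of labels. In a row a larger second label
  lies further west; the order in \<open>up_north\<close> is direction first, label second, because
  diagonal tiles lie north of row tiles in a column.\<close>

locale arrow_filling =
  fixes A :: "nat set" and W :: "nat \<Rightarrow> nat" and g :: "nat \<Rightarrow> nat \<Rightarrow> arrow option"
  assumes finite_labels: "finite A"
    and dirs: "l \<in> A \<Longrightarrow> W l \<in> {0, 1, 2}"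
    and arrow_inversion: "g i j \<noteq> None \<Longrightarrow> i \<in> A \<and> j \<in> A \<and> i < j \<and> W j < W i"
    and left_row: "g i j = Some Left_Arrow \<Longrightarrow> W i = 2"
    and up_column: "g i j = Some Up_Arrow \<Longrightarrow> W j = 0"
    and left_west: "g i j = Some Left_Arrow \<Longrightarrow> j < j' \<Longrightarrow> g i j' = None"
    and up_north: "g i j = Some Up_Arrow \<Longrightarrow> W i' < W i \<or> W i' = W i \<and> i' < i \<Longrightarrow> g i' j = None"

text \<open>The gateway from tiles to labels. The support condition stays separate because
  \<open>arr\<close> cannot see values of the filling off the tiling.\<close>

lemma labeled_RAT_iff:
  "labeled_RAT T \<longleftrightarrow> bordered T \<and> (\<forall>t. filling T t \<noteq> None \<longrightarrow> t \<in> maximal_tiling (word T)) \<and>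
    arrow_filling (labels T) (dir T) (arr T)"
proof (cases "bordered T \<and> (\<forall>t. filling T t \<noteq> None \<longrightarrow> t \<in> maximal_tiling (word T))")
  case False
  then show ?thesis by (auto simp: labeled_RAT_def bordered_def)
next
  case True
  then have b: "bordered T" and supp: "\<And>t. filling T t \<noteq> None \<Longrightarrow> t \<in> maximal_tiling (word T)"
    by auto
  let ?c = "label_cell T" and ?I = "label_inversions T"
  have mt: "maximal_tiling (word T) = ?c ` ?I"
    using bij_betw_imp_surj_on[OF bij_betw_label_cell[OF b]] by simp
  have all: "(\<forall>t. filling T t = Some x \<longrightarrow> Q t) \<longleftrightarrow> (\<forall>i j. arr T i j = Some x \<longrightarrow> Q (?c (i, j)))"
    for x Q
  proof
    assume R: "\<forall>i j. arr T i j = Some x \<longrightarrow> Q (?c (i, j))"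
    show "\<forall>t. filling T t = Some x \<longrightarrow> Q t"
    proof (intro allI impI)
      fix t assume t: "filling T t = Some x"
      then obtain i j where "(i, j) \<in> ?I" "t = ?c (i, j)"
        using supp[of t] mt by auto
      then show "Q t" using R t by (auto simp: arr_def)
    qed
  qed (auto simp: arr_def split: if_splits)
  have arrI: "(i, j) \<in> ?I" if "arr T i j \<noteq> None" for i j
    using that by (auto simp: arr_def split: if_splits)
  have left: "(\<forall>t. filling T t = Some Left_Arrow \<longrightarrow> (\<exists>k. is_row (word T) k \<and> t \<in> strip (word T) k)) \<longleftrightarrow>
      (\<forall>i j. arr T i j = Some Left_Arrow \<longrightarrow> dir T i = 2)"
    unfolding all using label_cell_in_row[OF b arrI] by auto
  have up: "(\<forall>t. filling T t = Some Up_Arrow \<longrightarrow> (\<exists>k. is_column (word T) k \<and> t \<in> strip (word T) k)) \<longleftrightarrow>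
      (\<forall>i j. arr T i j = Some Up_Arrow \<longrightarrow> dir T j = 0)"
    unfolding all using label_cell_in_column[OF b arrI] by auto
  have points: "points_to T (?c (i, j)) (?c (i', j')) \<longleftrightarrow>
      arr T i j = Some Left_Arrow \<and> dir T i = 2 \<and> i = i' \<and> j < j' \<or>
      arr T i j = Some Up_Arrow \<and> dir T j = 0 \<and> j = j' \<and>
        (dir T i' < dir T i \<or> dir T i' = dir T i \<and> i' < i)"
    if "(i, j) \<in> ?I" "(i', j') \<in> ?I" for i j i' j'
    unfolding points_to_def label_row_west_iff[OF b that] label_column_north_iff[OF b that]
    using that by (simp add: arr_def)
  have point: "(\<forall>t t'. points_to T t t' \<longrightarrow> filling T t' = None) \<longleftrightarrow>
      (\<forall>i j i' j'. (i, j) \<in> ?I \<longrightarrow> (i', j') \<in> ?I \<longrightarrow> points_to T (?c (i, j)) (?c (i', j')) \<longrightarrow>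
        arr T i' j' = None)"
  proof
    assume L: "\<forall>t t'. points_to T t t' \<longrightarrow> filling T t' = None"
    then show "\<forall>i j i' j'. (i, j) \<in> ?I \<longrightarrow> (i', j') \<in> ?I \<longrightarrow>
        points_to T (?c (i, j)) (?c (i', j')) \<longrightarrow> arr T i' j' = None"
      by (auto simp: arr_def)
  next
    assume R: "\<forall>i j i' j'. (i, j) \<in> ?I \<longrightarrow> (i', j') \<in> ?I \<longrightarrow>
        points_to T (?c (i, j)) (?c (i', j')) \<longrightarrow> arr T i' j' = None"
    show "\<forall>t t'. points_to T t t' \<longrightarrow> filling T t' = None"
    proof (intro allI impI; rule ccontr)
      fix t t' assume p: "points_to T t t'" and ne: "filling T t' \<noteq> None"
      \<comment> \<open>Both ends of a violation are nonempty, hence tiles of the diagram, hence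
        cells of label pairs.\<close>
      have "filling T t \<noteq> None" using p by (auto simp: points_to_def)
      then obtain i j i' j' where "(i, j) \<in> ?I" "t = ?c (i, j)" "(i', j') \<in> ?I" "t' = ?c (i', j')"
        using supp[of t] supp[of t'] ne mt by auto
      then show False using R p ne by (auto simp: arr_def)
    qed
  qed
  have "arrow_filling (labels T) (dir T) (arr T) \<longleftrightarrow>
      (\<forall>i j. arr T i j = Some Left_Arrow \<longrightarrow> dir T i = 2) \<and>
      (\<forall>i j. arr T i j = Some Up_Arrow \<longrightarrow> dir T j = 0) \<and>
      (\<forall>i j i' j'. (i, j) \<in> ?I \<longrightarrow> (i', j') \<in> ?I \<longrightarrow> points_to T (?c (i, j)) (?c (i', j')) \<longrightarrow>
        arr T i' j' = None)" (is "?L \<longleftrightarrow> ?R")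
  proof
    assume ?L
    then interpret arrow_filling "labels T" "dir T" "arr T" .
    show ?R
    proof (intro conjI allI impI)
      show "arr T i j = Some Left_Arrow \<Longrightarrow> dir T i = 2" for i j
        by (rule left_row)
      show "arr T i j = Some Up_Arrow \<Longrightarrow> dir T j = 0" for i j
        by (rule up_column)
      show "arr T i' j' = None" if "(i, j) \<in> ?I" "(i', j') \<in> ?I"
        "points_to T (?c (i, j)) (?c (i', j'))" for i j i' j'
        using that(3) unfolding points[OF that(1,2)]
        using left_west[of i j j'] up_north[of i j i'] by blast
    qed
  next
    assume R: ?R
    have none: "arr T i' j' = None" if "(i, j) \<in> ?I" "(i', j') \<in> ?I"
      "points_to T (?c (i, j)) (?c (i', j'))" for i j i' j'
      by (rule R[THEN conjunct2, THEN conjunct2, rule_format, OF that])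
    show ?L
    proof
      show "finite (labels T)" using b by (simp add: bordered_def)
      show "l \<in> labels T \<Longrightarrow> dir T l \<in> {0, 1, 2}" for l
        by (rule dir_cases[OF b])
      show "arr T i j \<noteq> None \<Longrightarrow> i \<in> labels T \<and> j \<in> labels T \<and> i < j \<and> dir T j < dir T i" for i j
        using arrI[of i j] by (auto simp: label_inversions_def)
      show lr: "arr T i j = Some Left_Arrow \<Longrightarrow> dir T i = 2" for i j
        using R by blast
      show uc: "arr T i j = Some Up_Arrow \<Longrightarrow> dir T j = 0" for i j
        using R by blast
      show "arr T i j' = None" if "arr T i j = Some Left_Arrow" "j < j'" for i j j'
      proof (rule ccontr)
        assume ne: "arr T i j' \<noteq> None"
        have I: "(i, j) \<in> ?I" "(i, j') \<in> ?I"
          using arrI that(1) ne by auto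
        have "points_to T (?c (i, j)) (?c (i, j'))"
          unfolding points[OF I] using that lr[OF that(1)] by simp
        then show False
          using none[OF I] ne by simp
      qed
      show "arr T i' j = None"
        if "arr T i j = Some Up_Arrow" "dir T i' < dir T i \<or> dir T i' = dir T i \<and> i' < i" for i j i'
      proof (rule ccontr)
        assume ne: "arr T i' j \<noteq> None"
        have I: "(i, j) \<in> ?I" "(i', j) \<in> ?I"
          using arrI that(1) ne by auto
        have "points_to T (?c (i, j)) (?c (i', j))"
          unfolding points[OF I] using that uc[OF that(1)] by simp
        then show False
          using none[OF I] ne by simp
      qed
    qed
  qed
  then show ?thesis
    using True left up point unfolding labeled_RAT_def bordered_def by blast
qed

lemma labeled_RAT_eqI:
  assumes "labeled_RAT T" "labeled_RAT T'" "labels T = labels T'"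
    and "\<And>l. l \<in> labels T \<Longrightarrow> dir T l = dir T' l"
    and "\<And>i j. arr T i j = arr T' i j"
  shows "T = T'"
proof -
  have b: "bordered T" "bordered T'"
    and supp: "\<And>t. filling T t \<noteq> None \<Longrightarrow> t \<in> maximal_tiling (word T)"
      "\<And>t. filling T' t \<noteq> None \<Longrightarrow> t \<in> maximal_tiling (word T')"
    using assms(1,2) by (auto simp: labeled_RAT_iff)
  have fin: "finite (labels T)" and len: "length (word T) = card (labels T)"
    "length (word T') = card (labels T)"
    using b assms(3) by (auto simp: bordered_def)
  have w: "word T = word T'"
  proof (rule nth_equalityI)
    show "length (word T) = length (word T')" using len by simp
  next
    fix k assume "k < length (word T)"
    then have "k \<in> rank (labels T) ` labels T"
      using bij_betw_imp_surj_on[OF bij_betw_rank[OF fin]] len by simp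
    then show "word T ! k = word T' ! k"
      using assms(3,4) by (auto simp: dir_def)
  qed
  have I: "label_inversions T = label_inversions T'" "label_cell T = label_cell T'"
    using assms(3) w by (auto simp: label_inversions_def label_cell_def dir_def)
  have "filling T t = filling T' t" for t
  proof (cases "t \<in> maximal_tiling (word T)")
    case True
    then obtain i j where "(i, j) \<in> label_inversions T" "t = label_cell T (i, j)"
      using bij_betw_imp_surj_on[OF bij_betw_label_cell[OF b(1)]] by (metis imageE surj_pair)
    then show ?thesis
      using assms(5)[of i j] I by (simp add: arr_def)
  next
    case False
    then show ?thesis using supp w by metis
  qed
  then show ?thesis
    using assms(3) w by (intro labeled_filling.equality) auto
qed

text \<open>Built in two stages: \<open>label_cell\<close> and \<open>label_inversions\<close>
  depend only on labels and word, so they are taken from an empty filling and then transport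
  \<open>g\<close> to the tiles.\<close>

definition make_filling :: "nat set \<Rightarrow> (nat \<Rightarrow> nat) \<Rightarrow> (nat \<Rightarrow> nat \<Rightarrow> arrow option) \<Rightarrow> labeled_filling" where
  "make_filling A W g =
    (let T = \<lparr>labels = A, word = map W (sorted_list_of_set A), filling = \<lambda>_. None\<rparr> in
      T\<lparr>filling := \<lambda>t. if t \<in> label_cell T ` label_inversions T
        then case_prod g (inv_into (label_inversions T) (label_cell T) t) else None\<rparr>)"

lemma dir_map:
  assumes "finite (labels T)" "word T = map W (sorted_list_of_set (labels T))" "l \<in> labels T"
  shows "dir T l = W l"
  using assms rank_less_card[OF assms(1,3)] nth_sorted_rank[OF assms(1,3)] by (simp add: dir_def)

lemma
  assumes "arrow_filling A W g"
  shows labeled_RAT_make: "labeled_RAT (make_filling A W g)"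
    and labels_make: "labels (make_filling A W g) = A"
    and dir_make: "l \<in> A \<Longrightarrow> dir (make_filling A W g) l = W l"
    and arr_make: "arr (make_filling A W g) i j = g i j"
proof -
  interpret arrow_filling A W g by fact
  define T where "T = make_filling A W g"
  define T0 where "T0 = \<lparr>labels = A, word = map W (sorted_list_of_set A), filling = \<lambda>_. None\<rparr>"
  have lw: "labels T = A" "word T = map W (sorted_list_of_set A)" "labels T0 = A" "word T0 = word T"
    by (simp_all add: T_def T0_def make_filling_def Let_def)
  have c: "label_cell T = label_cell T0" "label_inversions T = label_inversions T0"
    by (simp_all add: label_cell_def label_inversions_def dir_def lw)
  have f: "filling T t = (if t \<in> label_cell T ` label_inversions T
      then case_prod g (inv_into (label_inversions T) (label_cell T) t) else None)" for t
    unfolding c by (simp add: T_def T0_def make_filling_def Let_def)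
  show labels: "labels (make_filling A W g) = A"
    using lw by (simp add: T_def)
  have dir: "dir T l = W l" if "l \<in> A" for l
    using finite_labels that lw by (intro dir_map) auto
  then show "l \<in> A \<Longrightarrow> dir (make_filling A W g) l = W l"
    by (simp add: T_def)
  have "W ` A \<subseteq> {0, 1, 2}"
    using dirs by (rule image_subsetI)
  then have b: "bordered T"
    using finite_labels by (simp add: bordered_def lw)
  have inv: "(i, j) \<in> label_inversions T" if "g i j \<noteq> None" for i j
    using arrow_inversion[OF that] dir by (simp add: label_inversions_def lw)
  have arr: "arr T i j = g i j" for i j
  proof (cases "(i, j) \<in> label_inversions T")
    case True
    then show ?thesis
      using bij_betw_imp_inj_on[OF bij_betw_label_cell[OF b]] by (simp add: arr_def f)
  next
    case False
    then show ?thesis using inv[of i j] by (simp add: arr_def) (metis not_None_eq)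
  qed
  then show "arr (make_filling A W g) i j = g i j"
    by (simp add: T_def)
  have "t \<in> maximal_tiling (word T)" if "filling T t \<noteq> None" for t
    using that f[of t] bij_betw_imp_surj_on[OF bij_betw_label_cell[OF b]] by (auto split: if_splits)
  moreover have "arrow_filling (labels T) (dir T) (arr T)"
  proof
    show "finite (labels T)" using finite_labels lw by simp
    show "l \<in> labels T \<Longrightarrow> dir T l \<in> {0, 1, 2}" for l
      by (rule dir_cases[OF b])
    show "arr T i j \<noteq> None \<Longrightarrow> i \<in> labels T \<and> j \<in> labels T \<and> i < j \<and> dir T j < dir T i" for i j
      using inv[of i j] by (auto simp: arr label_inversions_def)
    show "dir T i = 2" if "arr T i j = Some Left_Arrow" for i j
      using that left_row[of i j] arrow_inversion[of i j] dir by (simp add: arr)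
    show "dir T j = 0" if "arr T i j = Some Up_Arrow" for i j
      using that up_column[of i j] arrow_inversion[of i j] dir by (simp add: arr)
    show "arr T i j' = None" if "arr T i j = Some Left_Arrow" "j < j'" for i j j'
      using that left_west[of i j j'] by (simp add: arr)
    show "arr T i' j = None"
      if "arr T i j = Some Up_Arrow" "dir T i' < dir T i \<or> dir T i' = dir T i \<and> i' < i" for i j i'
    proof (rule ccontr)
      assume "arr T i' j \<noteq> None"
      then have "g i' j \<noteq> None" by (simp add: arr)
      moreover have "g i j = Some Up_Arrow" using that by (simp add: arr)
      ultimately show False
        using that(2) up_north[of i j i'] arrow_inversion[of i j] arrow_inversion[of i' j] dir by simp
    qed
  qed
  ultimately show "labeled_RAT (make_filling A W g)"
    using b unfolding T_def[symmetric] labeled_RAT_iff by blast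
qed

section \<open>Restriction to a set of labels\<close>

lemma labels_restrict [simp]: "labels (restrict_RAT T L) = L"
  by (simp add: restrict_RAT_def)

lemma word_restrict: "word (restrict_RAT T L) = map (dir T) (sorted_list_of_set L)"
  by (simp add: restrict_RAT_def subword_def dir_def)

text \<open>Deleting strips keeps the directions and inversions of the remaining labels but moves
  their tiles; \<open>same_cell\<close> matches old and new tiles through the labels.\<close>

lemma
  assumes "bordered T" "L \<subseteq> labels T"
  shows dir_restrict: "l \<in> L \<Longrightarrow> dir (restrict_RAT T L) l = dir T l"
    and bordered_restrict: "bordered (restrict_RAT T L)"
    and arr_restrict: "arr (restrict_RAT T L) i j = (if i \<in> L \<and> j \<in> L then arr T i j else None)"
    and filling_restrict:
      "filling (restrict_RAT T L) t \<noteq> None \<Longrightarrow> t \<in> maximal_tiling (word (restrict_RAT T L))"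
proof -
  let ?R = "restrict_RAT T L"
  have fin: "finite L" using assms by (auto simp: bordered_def intro: finite_subset)
  show dir: "l \<in> L \<Longrightarrow> dir ?R l = dir T l" for l
    by (rule dir_map) (auto simp: fin word_restrict)
  have "dir T ` L \<subseteq> {0, 1, 2}"
    using dir_cases[OF assms(1) subsetD[OF assms(2)]] by (rule image_subsetI)
  then show b: "bordered ?R"
    using fin by (simp add: bordered_def word_restrict)
  have inv: "(i, j) \<in> label_inversions ?R \<longleftrightarrow> i \<in> L \<and> j \<in> L \<and> (i, j) \<in> label_inversions T" for i j
    using dir assms(2) by (auto simp: label_inversions_def)
  have sw: "subword T L = word ?R"
    by (simp add: restrict_RAT_def)
  have same: "same_cell T L t' t \<longleftrightarrow> (\<exists>i j. (i, j) \<in> label_inversions ?R \<and>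
      t' = label_cell ?R (i, j) \<and> t = label_cell T (i, j))" for t' t
    unfolding same_cell_def sw is_cell_iff[OF assms(1)]
    using is_cell_iff[OF b] inv by auto
  have f: "filling ?R t' = (if \<exists>t. same_cell T L t' t then filling T (THE t. same_cell T L t' t) else None)"
    for t'
    by (simp add: restrict_RAT_def)
  have inj: "inj_on (label_cell ?R) (label_inversions ?R)"
    using bij_betw_imp_inj_on[OF bij_betw_label_cell[OF b]] .
  \<comment> \<open>Injectivity of \<open>label_cell\<close> leaves a single candidate, so the
    definite description in \<open>restrict_RAT\<close> yields the intended tile.\<close>
  have same': "same_cell T L (label_cell ?R (i, j)) t \<longleftrightarrow> t = label_cell T (i, j)"
    if "(i, j) \<in> label_inversions ?R" for i j t
    unfolding same using inj_onD[OF inj _ that] that by blast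
  have "filling ?R (label_cell ?R (i, j)) = filling T (label_cell T (i, j))"
    if "(i, j) \<in> label_inversions ?R" for i j
    unfolding f same'[OF that] by simp
  then show "arr ?R i j = (if i \<in> L \<and> j \<in> L then arr T i j else None)"
    by (simp add: arr_def inv)
  show "t \<in> maximal_tiling (word ?R)" if "filling ?R t \<noteq> None" for t
    using that f[of t] same[of t] bij_betw_imp_surj_on[OF bij_betw_label_cell[OF b]]
    by (auto split: if_splits)
qed

text \<open>Each axiom constrains only one or two nonempty cells through directions and label order,
  so a smaller set of labels inherits it.\<close>

lemma labeled_RAT_restrict:
  assumes "labeled_RAT T" "L \<subseteq> labels T"
  shows "labeled_RAT (restrict_RAT T L)"
proof -
  have b: "bordered T" and "arrow_filling (labels T) (dir T) (arr T)"
    using assms(1) by (auto simp: labeled_RAT_iff)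
  then interpret arrow_filling "labels T" "dir T" "arr T" by simp
  note R = dir_restrict[OF b assms(2)] arr_restrict[OF b assms(2)]
  have "arrow_filling L (dir (restrict_RAT T L)) (arr (restrict_RAT T L))"
  proof
    show "finite L" using finite_labels assms(2) by (rule rev_finite_subset)
    show "l \<in> L \<Longrightarrow> dir (restrict_RAT T L) l \<in> {0, 1, 2}" for l
      using R(1)[of l] dirs[of l] assms(2) by auto
    show "arr (restrict_RAT T L) i j \<noteq> None \<Longrightarrow>
        i \<in> L \<and> j \<in> L \<and> i < j \<and> dir (restrict_RAT T L) j < dir (restrict_RAT T L) i" for i j
      using R(1) arrow_inversion[of i j] by (auto simp: R(2) split: if_splits)
    show "arr (restrict_RAT T L) i j = Some Left_Arrow \<Longrightarrow> dir (restrict_RAT T L) i = 2" for i j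
      using R(1) left_row[of i j] by (auto simp: R(2) split: if_splits)
    show "arr (restrict_RAT T L) i j = Some Up_Arrow \<Longrightarrow> dir (restrict_RAT T L) j = 0" for i j
      using R(1) up_column[of i j] by (auto simp: R(2) split: if_splits)
    show "arr (restrict_RAT T L) i j' = None"
      if "arr (restrict_RAT T L) i j = Some Left_Arrow" "j < j'" for i j j'
      using that left_west[of i j j'] by (auto simp: R(2) split: if_splits)
    show "arr (restrict_RAT T L) i' j = None"
      if "arr (restrict_RAT T L) i j = Some Up_Arrow"
        "dir (restrict_RAT T L) i' < dir (restrict_RAT T L) i \<or>
          dir (restrict_RAT T L) i' = dir (restrict_RAT T L) i \<and> i' < i" for i j i'
      using that R(1)[of i] R(1)[of i'] up_north[of i j i'] by (auto simp: R(2) split: if_splits)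
  qed
  then show ?thesis
    using bordered_restrict[OF b assms(2)] filling_restrict[OF b assms(2)] by (simp add: labeled_RAT_iff)
qed

section \<open>Counting arrows and free strips through labels\<close>

lemma arrow_pairs_arr:
  assumes "bordered T"
  shows "arrow_pairs T = {(i, j). arr T i j \<noteq> None}"
  unfolding arrow_pairs_def is_cell_iff[OF assms] by (auto simp: arr_def split: if_splits)

lemma card_filling:
  assumes "bordered T" "\<And>t. filling T t \<noteq> None \<Longrightarrow> t \<in> maximal_tiling (word T)"
  shows "card {t. filling T t \<noteq> None} = card {(i, j). arr T i j \<noteq> None}"
proof -
  have b: "bij_betw (label_cell T) (label_inversions T) (maximal_tiling (word T))"
    by (rule bij_betw_label_cell[OF assms(1)])
  have sub: "{(i, j). arr T i j \<noteq> None} \<subseteq> label_inversions T"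
    by (auto simp: arr_def split: if_splits)
  have "{t. filling T t \<noteq> None} = label_cell T ` {(i, j). arr T i j \<noteq> None}"
  proof (rule subset_antisym; rule subsetI)
    fix t assume "t \<in> {t. filling T t \<noteq> None}"
    then have t: "filling T t \<noteq> None" by simp
    then have "t \<in> label_cell T ` label_inversions T"
      using assms(2) bij_betw_imp_surj_on[OF b] by simp
    then obtain i j where ij: "(i, j) \<in> label_inversions T" "t = label_cell T (i, j)" by auto
    then have "arr T i j \<noteq> None" using t by (simp add: arr_def)
    then show "t \<in> label_cell T ` {(i, j). arr T i j \<noteq> None}"
      using ij(2) by blast
  qed (auto simp: arr_def split: if_splits)
  then show ?thesis
    using inj_on_subset[OF bij_betw_imp_inj_on[OF b] sub] by (simp add: card_image)
qed

lemma strip_filling_iff: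
  assumes "bordered T" "l \<in> labels T"
  shows "(\<forall>t \<in> strip (word T) (rank (labels T) l). filling T t \<noteq> Some x) \<longleftrightarrow>
    (\<forall>j. arr T l j \<noteq> Some x \<and> arr T j l \<noteq> Some x)"
  unfolding strip_label_cells[OF assms] by (auto simp: arr_def)

text \<open>A row has the largest direction, so its label is never the second one of a nonempty
  cell.\<close>

lemma row_strip_free_iff:
  assumes "labeled_RAT T" "l \<in> labels T" "dir T l = 2"
  shows "(\<forall>t \<in> strip (word T) (rank (labels T) l). filling T t \<noteq> Some Left_Arrow) \<longleftrightarrow>
    (\<forall>j. arr T l j \<noteq> Some Left_Arrow)"
proof -
  have b: "bordered T" and "arrow_filling (labels T) (dir T) (arr T)"
    using assms(1) by (auto simp: labeled_RAT_iff)
  then interpret arrow_filling "labels T" "dir T" "arr T" by simp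
  have "arr T j l \<noteq> Some Left_Arrow" for j
    using arrow_inversion[of j l] left_row[of j l] assms(3) by auto
  then show ?thesis
    using strip_filling_iff[OF b assms(2)] by simp
qed

lemma column_strip_free_iff:
  assumes "labeled_RAT T" "l \<in> labels T" "dir T l = 0"
  shows "(\<forall>t \<in> strip (word T) (rank (labels T) l). filling T t \<noteq> Some Up_Arrow) \<longleftrightarrow>
    (\<forall>i. arr T i l \<noteq> Some Up_Arrow)"
proof -
  have b: "bordered T" and "arrow_filling (labels T) (dir T) (arr T)"
    using assms(1) by (auto simp: labeled_RAT_iff)
  then interpret arrow_filling "labels T" "dir T" "arr T" by simp
  have "arr T l j \<noteq> Some Up_Arrow" for j
    using arrow_inversion[of l j] assms(3) by auto
  then show ?thesis
    using strip_filling_iff[OF b assms(2)] by simp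
qed

lemma card_rank_image:
  assumes "bordered T" "\<And>k. P k \<Longrightarrow> k < length (word T)"
  shows "card {k. P k} = card {l \<in> labels T. P (rank (labels T) l)}"
proof -
  have b: "bij_betw (rank (labels T)) (labels T) {..<length (word T)}"
    using assms(1) bij_betw_rank[of "labels T"] by (simp add: bordered_def)
  have "{k. P k} = {k \<in> rank (labels T) ` labels T. P k}"
    using bij_betw_imp_surj_on[OF b] assms(2) by auto
  also have "\<dots> = rank (labels T) ` {l \<in> labels T. P (rank (labels T) l)}"
    by auto
  finally show ?thesis
    using inj_on_subset[OF bij_betw_imp_inj_on[OF b]] by (simp add: card_image)
qed

lemma card_row_free:
  assumes "labeled_RAT T"
  shows "card {k. row_free T k} =
    card {l \<in> labels T. dir T l = 2 \<and> (\<forall>j. arr T l j \<noteq> Some Left_Arrow)}"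
proof -
  have b: "bordered T" using assms by (simp add: labeled_RAT_iff)
  have "row_free T (rank (labels T) l) \<longleftrightarrow> dir T l = 2 \<and> (\<forall>j. arr T l j \<noteq> Some Left_Arrow)"
    if "l \<in> labels T" for l
    using row_strip_free_iff[OF assms that] rank_less_card[OF _ that] b
    by (auto simp: row_free_def is_row_def dir_def bordered_def)
  then have "{l \<in> labels T. row_free T (rank (labels T) l)} =
      {l \<in> labels T. dir T l = 2 \<and> (\<forall>j. arr T l j \<noteq> Some Left_Arrow)}"
    by blast
  then show ?thesis
    using card_rank_image[OF b, of "row_free T"] by (simp add: row_free_def is_row_def)
qed

lemma card_column_free:
  assumes "labeled_RAT T"
  shows "card {k. column_free T k} =
    card {l \<in> labels T. dir T l = 0 \<and> (\<forall>i. arr T i l \<noteq> Some Up_Arrow)}"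
proof -
  have b: "bordered T" using assms by (simp add: labeled_RAT_iff)
  have "column_free T (rank (labels T) l) \<longleftrightarrow> dir T l = 0 \<and> (\<forall>i. arr T i l \<noteq> Some Up_Arrow)"
    if "l \<in> labels T" for l
    using column_strip_free_iff[OF assms that] rank_less_card[OF _ that] b
    by (auto simp: column_free_def is_column_def dir_def bordered_def)
  then have "{l \<in> labels T. column_free T (rank (labels T) l)} =
      {l \<in> labels T. dir T l = 0 \<and> (\<forall>i. arr T i l \<noteq> Some Up_Arrow)}"
    by blast
  then show ?thesis
    using card_rank_image[OF b, of "column_free T"] by (simp add: column_free_def is_column_def)
qed

lemma top_row_free_iff:
  assumes "labeled_RAT T"
  shows "(\<exists>k. is_row (word T) k \<and> (\<forall>k'. is_row (word T) k' \<longrightarrow> k \<le> k') \<and>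
      (\<forall>t \<in> strip (word T) k. filling T t \<noteq> Some Left_Arrow)) \<longleftrightarrow>
    (\<exists>l \<in> labels T. dir T l = 2 \<and> (\<forall>l' \<in> labels T. dir T l' = 2 \<longrightarrow> l \<le> l') \<and>
      (\<forall>j. arr T l j \<noteq> Some Left_Arrow))" (is "?L \<longleftrightarrow> ?R")
proof -
  have b: "bordered T" and fin: "finite (labels T)"
    using assms by (auto simp: labeled_RAT_iff bordered_def)
  have least: "(\<forall>k'. is_row (word T) k' \<longrightarrow> rank (labels T) l \<le> k') \<longleftrightarrow>
      (\<forall>l' \<in> labels T. dir T l' = 2 \<longrightarrow> l \<le> l')" if "l \<in> labels T" for l
    using ex_strip_label[OF b, of "\<lambda>k. word T ! k = 2 \<and> k < rank (labels T) l"]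
      rank_less_iff[OF fin _ that]
    by (auto simp: is_row_def dir_def simp flip: not_less)
  have "?L \<longleftrightarrow> (\<exists>l \<in> labels T. dir T l = 2 \<and>
      (\<forall>k'. is_row (word T) k' \<longrightarrow> rank (labels T) l \<le> k') \<and>
      (\<forall>t \<in> strip (word T) (rank (labels T) l). filling T t \<noteq> Some Left_Arrow))"
    using ex_strip_label[OF b, of "\<lambda>k. word T ! k = 2 \<and> (\<forall>k'. is_row (word T) k' \<longrightarrow> k \<le> k') \<and>
      (\<forall>t \<in> strip (word T) k. filling T t \<noteq> Some Left_Arrow)"]
    by (simp add: is_row_def dir_def conj_assoc)
  also have "\<dots> \<longleftrightarrow> ?R"
    by (rule bex_cong conj_cong refl least row_strip_free_iff[OF assms] | assumption)+
  finally show ?thesis .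
qed

lemma leftmost_column_free_iff:
  assumes "labeled_RAT T"
  shows "(\<exists>k. is_column (word T) k \<and> (\<forall>k'. is_column (word T) k' \<longrightarrow> k' \<le> k) \<and>
      (\<forall>t \<in> strip (word T) k. filling T t \<noteq> Some Up_Arrow)) \<longleftrightarrow>
    (\<exists>l \<in> labels T. dir T l = 0 \<and> (\<forall>l' \<in> labels T. dir T l' = 0 \<longrightarrow> l' \<le> l) \<and>
      (\<forall>i. arr T i l \<noteq> Some Up_Arrow))" (is "?L \<longleftrightarrow> ?R")
proof -
  have b: "bordered T" and fin: "finite (labels T)"
    using assms by (auto simp: labeled_RAT_iff bordered_def)
  have greatest: "(\<forall>k'. is_column (word T) k' \<longrightarrow> k' \<le> rank (labels T) l) \<longleftrightarrow>
      (\<forall>l' \<in> labels T. dir T l' = 0 \<longrightarrow> l' \<le> l)" if "l \<in> labels T" for l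
    using ex_strip_label[OF b, of "\<lambda>k. word T ! k = 0 \<and> rank (labels T) l < k"]
      rank_less_iff[OF fin that]
    by (auto simp: is_column_def dir_def simp flip: not_less)
  have "?L \<longleftrightarrow> (\<exists>l \<in> labels T. dir T l = 0 \<and>
      (\<forall>k'. is_column (word T) k' \<longrightarrow> k' \<le> rank (labels T) l) \<and>
      (\<forall>t \<in> strip (word T) (rank (labels T) l). filling T t \<noteq> Some Up_Arrow))"
    using ex_strip_label[OF b, of "\<lambda>k. word T ! k = 0 \<and> (\<forall>k'. is_column (word T) k' \<longrightarrow> k' \<le> k) \<and>
      (\<forall>t \<in> strip (word T) k. filling T t \<noteq> Some Up_Arrow)"]
    by (simp add: is_column_def dir_def conj_assoc)
  also have "\<dots> \<longleftrightarrow> ?R"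
    by (rule bex_cong conj_cong refl greatest column_strip_free_iff[OF assms] | assumption)+
  finally show ?thesis .
qed


section \<open>The forest of arrows\<close>

context arrow_filling
begin

text \<open>
  An arrow is read as a step from the row (column) that carries it as a left-arrow (up-arrow) to the
  other strip of its cell; the roots are then the free rows, the free columns and the diagonal edges.
\<close>

definition step :: "(nat \<times> nat) set" where
  "step = {(i, j). g i j = Some Left_Arrow} \<union> {(j, i). g i j = Some Up_Arrow}"

definition roots :: "nat set" where
  "roots = A - Domain step"

definition root :: "nat \<Rightarrow> nat" where
  "root x = (THE y. (x, y) \<in> step\<^sup>* \<and> y \<in> roots)"

lemma dir_cases: "x \<in> A \<Longrightarrow> W x = 0 \<or> W x = 1 \<or> W x = 2"
  using dirs[of x] by auto

lemma finite_roots: "finite roots"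
  using finite_labels by (simp add: roots_def)

lemma arrow_step:
  assumes "g i j \<noteq> None"
  shows "(i, j) \<in> step \<or> (j, i) \<in> step"
proof -
  obtain a where a: "g i j = Some a" using assms by auto
  then show ?thesis by (cases a) (auto simp: step_def)
qed

lemma step_cases:
  assumes "(x, y) \<in> step"
  obtains "g x y = Some Left_Arrow" "x \<in> A" "y \<in> A" "x < y" "W x = 2" "W y = 0 \<or> W y = 1"
  | "g y x = Some Up_Arrow" "x \<in> A" "y \<in> A" "y < x" "W x = 0" "W y = 1 \<or> W y = 2"
proof -
  consider "g x y = Some Left_Arrow" | "g y x = Some Up_Arrow"
    using assms by (auto simp: step_def)
  then show ?thesis
  proof cases
    case 1
    then show ?thesis
      using that(1) arrow_inversion[of x y] left_row[of x y] dir_cases[of y] by fastforce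
  next
    case 2
    then show ?thesis
      using that(2) arrow_inversion[of y x] up_column[of y x] dir_cases[of y] by fastforce
  qed
qed

lemma step_in_labels:
  assumes "(x, y) \<in> step"
  shows "x \<in> A" "y \<in> A" "x \<noteq> y"
  using assms by (cases rule: step_cases; simp)+

text \<open>Two left-arrows in one row, or two up-arrows in one column, are comparable in the
  pointing order, so one would point to the other. Left-arrows leave rows and up-arrows leave
  columns, so the kinds never mix.\<close>

lemma step_functional:
  assumes "(x, y) \<in> step" "(x, z) \<in> step"
  shows "y = z"
  using assms(1)
proof (cases rule: step_cases)
  case 1
  show ?thesis
    using assms(2)
  proof (cases rule: step_cases)
    case 1
    then show ?thesis
      using \<open>g x y = Some Left_Arrow\<close> left_west[of x y z] left_west[of x z y]
      by (cases y z rule: linorder_cases) auto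
  qed (use 1 in simp)
next
  case 2
  show ?thesis
    using assms(2)
  proof (cases rule: step_cases)
    case 2
    then show ?thesis
      using \<open>g y x = Some Up_Arrow\<close> up_north[of y x z] up_north[of z x y]
      by (cases y z rule: linorder_cases; cases "W y" "W z" rule: linorder_cases) auto
  qed (use 2 in simp)
qed

text \<open>The up-arrow of column \<open>y\<close> sits in \<open>(z, y)\<close> and has nothing
  nonempty to its north. As \<open>(x, y)\<close> holds a left-arrow, it is a different cell and
  lies further south: \<open>z\<close> is diagonal or a higher row.\<close>

lemma two_steps_from_row:
  assumes "(x, y) \<in> step" "(y, z) \<in> step" "W x = 2"
  shows "x < y" "W y = 0" "W z = 1 \<or> W z = 2 \<and> z < x"
proof -
  have xy: "g x y = Some Left_Arrow" "x < y" "W y < 2"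
    using assms(1,3) by (cases rule: step_cases; auto)+
  have yz: "g z y = Some Up_Arrow" "W y = 0" "W z = 1 \<or> W z = 2"
    using assms(2) xy(3) by (cases rule: step_cases; simp)+
  show "x < y" "W y = 0" using xy yz by auto
  show "W z = 1 \<or> W z = 2 \<and> z < x"
    using yz up_north[of z y x] xy(1) assms(3) by (cases x z rule: linorder_cases) auto
qed

text \<open>The left-arrow of row \<open>y\<close> sits in \<open>(y, z)\<close> and has nothing
  nonempty to its west, while \<open>(y, x)\<close> holds an up-arrow; hence \<open>x < z\<close>.
  Row order is label order, so a diagonal \<open>z\<close> makes no exception here.\<close>

lemma two_steps_from_column:
  assumes "(x, y) \<in> step" "(y, z) \<in> step" "W x = 0"
  shows "y < x" "W y = 2" "x < z" "W z < 2"
proof -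
  have xy: "g y x = Some Up_Arrow" "y < x" "0 < W y"
    using assms(1,3) by (cases rule: step_cases; auto)+
  have yz: "g y z = Some Left_Arrow" "W y = 2" "W z < 2"
    using assms(2) xy(3) by (cases rule: step_cases; auto)+
  show "y < x" "W y = 2" "W z < 2" using xy yz by auto
  show "x < z"
    using yz xy left_west[of y z x] by (cases x z rule: linorder_cases) auto
qed

lemma Domain_step_dir: "(x, y) \<in> step \<Longrightarrow> W x = 0 \<or> W x = 2"
  by (erule step_cases) auto

text \<open>The label intervals spanned by consecutive arrows increase strictly, so there are no cycles.\<close>

lemma step_widen:
  assumes "(x, y) \<in> step" "(y, z) \<in> step" "z \<in> Domain step"
  shows "(x - y) + (y - x) < (y - z) + (z - y)"
proof -
  \<comment> \<open>With \<open>z\<close> diagonal the second interval could be shorter, but no step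
    leaves a diagonal label. On naturals the two truncated differences add up to the
    distance.\<close>
  have z: "W z \<noteq> 1" using assms(3) Domain_step_dir[of z] by auto
  consider "W x = 0" | "W x = 2" using Domain_step_dir[OF assms(1)] by auto
  then show ?thesis
  proof cases
    case 1
    then show ?thesis using two_steps_from_column[OF assms(1,2)] by simp
  next
    case 2
    then show ?thesis using two_steps_from_row[OF assms(1,2)] z by auto
  qed
qed

text \<open>Lengths belong to arrows, so the induction runs over steps, not labels: the length grows
  along a path that goes on and stays below \<open>Max A\<close>, and its distance to this bound is
  the measure.\<close>

lemma step_reaches_root:
  assumes "(x, y) \<in> step"
  shows "\<exists>r \<in> roots. (y, r) \<in> step\<^sup>*"
  using assms
proof (induction "Max A - ((x - y) + (y - x))" arbitrary: x y rule: less_induct)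
  case less
  have y: "y \<in> A" using less.prems by (rule step_in_labels)
  show ?case
  proof (cases "y \<in> Domain step")
    case False
    then show ?thesis using y by (auto simp: roots_def)
  next
    case True
    then obtain z where yz: "(y, z) \<in> step" by auto
    show ?thesis
    proof (cases "z \<in> Domain step")
      case False
      then have "z \<in> roots" using step_in_labels[OF yz] by (simp add: roots_def)
      then show ?thesis using yz by blast
    next
      case True
      have w: "(x - y) + (y - x) < (y - z) + (z - y)"
        using less.prems yz True by (rule step_widen)
      have "y \<le> Max A" "z \<le> Max A"
        using step_in_labels[OF yz] finite_labels by auto
      then have "Max A - ((y - z) + (z - y)) < Max A - ((x - y) + (y - x))"
        using w by linarith
      then obtain r where "r \<in> roots" "(z, r) \<in> step\<^sup>*"
        using less.hyps[OF _ yz] by blast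
      then show ?thesis using yz by (meson converse_rtrancl_into_rtrancl)
    qed
  qed
qed

lemma reaches_root:
  assumes "x \<in> A"
  shows "\<exists>r \<in> roots. (x, r) \<in> step\<^sup>*"
proof (cases "x \<in> Domain step")
  case True
  then obtain y where "(x, y) \<in> step" by auto
  then show ?thesis
    using step_reaches_root by (meson converse_rtrancl_into_rtrancl)
next
  case False
  then show ?thesis using assms by (auto simp: roots_def)
qed

lemma roots_final:
  assumes "r \<in> roots" "(r, y) \<in> step\<^sup>*"
  shows "y = r"
  using assms(2,1) by (cases rule: converse_rtranclE) (auto simp: roots_def)

text \<open>Paths from one label in a functional relation are comparable, and no step leaves a
  root.\<close>

lemma root_eqI:
  assumes "(x, r) \<in> step\<^sup>*" "r \<in> roots"
  shows "root x = r"
  unfolding root_def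
proof (rule the_equality)
  show "(x, r) \<in> step\<^sup>* \<and> r \<in> roots" using assms by simp
next
  fix y assume y: "(x, y) \<in> step\<^sup>* \<and> y \<in> roots"
  have "single_valued step"
    using step_functional by (rule single_valuedI)
  then have "(y, r) \<in> step\<^sup>* \<or> (r, y) \<in> step\<^sup>*"
    using single_valued_confluent assms(1) y by metis
  then show "y = r" using roots_final assms(2) y by metis
qed

lemma root_props:
  assumes "x \<in> A"
  shows "root x \<in> roots" "(x, root x) \<in> step\<^sup>*"
  using reaches_root[OF assms] root_eqI by auto

lemma root_in_roots: "r \<in> roots \<Longrightarrow> root r = r"
  by (rule root_eqI) auto

lemma roots_subset: "roots \<subseteq> A"
  by (auto simp: roots_def)

lemma root_step:
  assumes "(x, y) \<in> step"
  shows "root x = root y"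
proof (rule root_eqI)
  have y: "y \<in> A" using assms by (rule step_in_labels)
  show "(x, root y) \<in> step\<^sup>*"
    using assms root_props(2)[OF y] by (rule converse_rtrancl_into_rtrancl)
  show "root y \<in> roots" using y by (rule root_props)
qed

lemma root_arrow: "g i j \<noteq> None \<Longrightarrow> root i = root j"
  using arrow_step root_step by metis

text \<open>Each arrow is charged to the source of its step; functionality makes this injective, and
  the sources are exactly the non-roots.\<close>

lemma card_arrows: "card {(i, j). g i j \<noteq> None} = card (A - roots)"
proof -
  let ?f = "\<lambda>(i, j). if g i j = Some Left_Arrow then i else j"
  let ?h = "\<lambda>(i, j). if g i j = Some Left_Arrow then j else i"
  have f: "(?f p, ?h p) \<in> step" if "p \<in> {(i, j). g i j \<noteq> None}" for p
  proof -
    obtain i j a where "p = (i, j)" "g i j = Some a" using \<open>p \<in> _\<close> by auto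
    then show ?thesis by (cases a) (auto simp: step_def)
  qed
  have "bij_betw ?f {(i, j). g i j \<noteq> None} (Domain step)"
  proof (rule bij_betw_imageI)
    show "inj_on ?f {(i, j). g i j \<noteq> None}"
    proof (rule inj_onI)
      fix p q
      assume p: "p \<in> {(i, j). g i j \<noteq> None}" and q: "q \<in> {(i, j). g i j \<noteq> None}"
        and eq: "?f p = ?f q"
      have "(?f p, ?h q) \<in> step" using f[OF q] unfolding eq[symmetric] .
      then have h: "?h p = ?h q" by (rule step_functional[OF f[OF p]])
      obtain i j k l where [simp]: "p = (i, j)" "q = (k, l)" by (cases p; cases q)
      \<comment> \<open>Equal sources and targets leave the same cell or the transposed one; the
        order of the labels excludes the latter.\<close>
      have "i < j" "k < l" using p q arrow_inversion by auto
      then show "p = q"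
        using eq h by (auto split: if_splits)
    qed
    show "?f ` {(i, j). g i j \<noteq> None} = Domain step"
    proof (rule subset_antisym; rule subsetI)
      fix x assume "x \<in> ?f ` {(i, j). g i j \<noteq> None}"
      then show "x \<in> Domain step" using f by blast
    next
      fix x assume "x \<in> Domain step"
      then obtain y where "(x, y) \<in> step" by auto
      then consider "g x y = Some Left_Arrow" | "g y x = Some Up_Arrow"
        by (auto simp: step_def)
      then show "x \<in> ?f ` {(i, j). g i j \<noteq> None}"
      proof cases
        case 1
        then show ?thesis by (intro image_eqI[of _ _ "(x, y)"]) auto
      next
        case 2
        then show ?thesis by (intro image_eqI[of _ _ "(y, x)"]) auto
      qed
    qed
  qed
  then have "card {(i, j). g i j \<noteq> None} = card (Domain step)"
    by (rule bij_betw_same_card)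
  moreover have "Domain step = A - roots"
    using step_in_labels by (auto simp: roots_def)
  ultimately show ?thesis by simp
qed

text \<open>One arrow per non-root; for empty \<open>A\<close> both sides fail.\<close>

lemma card_arrows_iff:
  "Suc (card {(i, j). g i j \<noteq> None}) = card A \<longleftrightarrow> card roots = 1"
proof -
  have "card roots \<le> card A"
    using finite_labels roots_subset by (rule card_mono)
  then show ?thesis
    unfolding card_arrows card_Diff_subset[OF finite_roots roots_subset] by linarith
qed

text \<open>Arrows join labels with equal roots, which gives one inclusion. Conversely the path to
  the root consists of arrows, so every equivalence containing the arrows links a label to its
  root.\<close>

lemma Inter_equiv_arrows:
  "\<Inter> {R. equiv A R \<and> {(i, j). g i j \<noteq> None} \<subseteq> R} = {(x, y) \<in> A \<times> A. root x = root y}"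
  (is "\<Inter> ?E = ?R")
proof (rule subset_antisym)
  have "equiv A ?R"
    by (auto intro!: equivI refl_onI symI transI)
  moreover have "{(i, j). g i j \<noteq> None} \<subseteq> ?R"
    using arrow_inversion root_arrow by blast
  ultimately show "\<Inter> ?E \<subseteq> ?R" by (intro Inter_lower) simp
  show "?R \<subseteq> \<Inter> ?E"
  proof (rule Inter_greatest)
    fix R assume "R \<in> ?E"
    then have eq: "equiv A R" and sub: "\<And>i j. g i j \<noteq> None \<Longrightarrow> (i, j) \<in> R" by auto
    have sym: "(y, x) \<in> R" if "(x, y) \<in> R" for x y
      using eq that by (auto simp: equiv_def dest: symD)
    have trans: "(x, z) \<in> R" if "(x, y) \<in> R" "(y, z) \<in> R" for x y z
      using eq that by (auto simp: equiv_def dest: transD)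
    have refl: "(x, x) \<in> R" if "x \<in> A" for x
      using eq that by (auto simp: equiv_def dest: refl_onD)
    have step: "(x, y) \<in> R" if "(x, y) \<in> step" for x y
      using that sub[of x y] sub[of y x] sym by (auto simp: step_def)
    have reach: "(x, y) \<in> R" if "(x, y) \<in> step\<^sup>*" "x \<in> A" for x y
      using that(1)
    proof induction
      case base
      show ?case using that(2) by (rule refl)
    qed (rule trans[OF _ step])
    show "?R \<subseteq> R"
    proof (rule subrelI)
      fix x y assume "(x, y) \<in> ?R"
      then have xy: "x \<in> A" "y \<in> A" "root x = root y" by auto
      have "(x, root x) \<in> R" "(y, root y) \<in> R"
        using reach[OF root_props(2)] xy(1,2) by blast+
      then show "(x, y) \<in> R" using sym trans xy(3) by metis
    qed
  qed
qed

lemma quotient_root: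
  "A // {(x, y) \<in> A \<times> A. root x = root y} = (\<lambda>r. {x \<in> A. root x = r}) ` roots"
proof (rule subset_antisym; rule subsetI)
  fix L assume "L \<in> A // {(x, y) \<in> A \<times> A. root x = root y}"
  then obtain x where x: "x \<in> A" "L = {(x, y) \<in> A \<times> A. root x = root y} `` {x}"
    by (rule quotientE)
  then have "L = {y \<in> A. root y = root x}" by auto
  then show "L \<in> (\<lambda>r. {x \<in> A. root x = r}) ` roots"
    using root_props(1)[OF x(1)] by blast
next
  fix L assume "L \<in> (\<lambda>r. {x \<in> A. root x = r}) ` roots"
  then obtain r where r: "r \<in> roots" "L = {x \<in> A. root x = r}" by auto
  have A: "r \<in> A" using r(1) roots_subset by auto
  have L: "L = {(x, y) \<in> A \<times> A. root x = root y} `` {r}"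
    using A root_in_roots[OF r(1)] r(2) by auto
  show "L \<in> A // {(x, y) \<in> A \<times> A. root x = root y}"
    unfolding L using A by (rule quotientI)
qed

section \<open>Roots by direction\<close>

lemma diagonal_in_roots: "x \<in> A \<Longrightarrow> W x = 1 \<Longrightarrow> x \<in> roots"
  using Domain_step_dir[of x] by (auto simp: roots_def)

lemma row_in_roots_iff:
  assumes "x \<in> A" "W x = 2"
  shows "x \<in> roots \<longleftrightarrow> (\<forall>j. g x j \<noteq> Some Left_Arrow)"
  using assms up_column[of _ x] by (auto simp: roots_def step_def)

lemma column_in_roots_iff:
  assumes "x \<in> A" "W x = 0"
  shows "x \<in> roots \<longleftrightarrow> (\<forall>i. g i x \<noteq> Some Up_Arrow)"
  using assms left_row[of x] by (auto simp: roots_def step_def)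

lemma top_row_root_iff:
  assumes "roots = {r}" "\<And>x. x \<in> A \<Longrightarrow> W x \<noteq> 1"
  shows "(\<exists>x \<in> A. W x = 2 \<and> (\<forall>x' \<in> A. W x' = 2 \<longrightarrow> x \<le> x') \<and> (\<forall>j. g x j \<noteq> Some Left_Arrow)) \<longleftrightarrow>
    W r = 2" (is "?L \<longleftrightarrow> _")
proof
  assume ?L
  then obtain x where "x \<in> A" "W x = 2" "\<forall>j. g x j \<noteq> Some Left_Arrow" by auto
  then show "W r = 2" using row_in_roots_iff[of x] assms(1) by simp
next
  assume r: "W r = 2"
  have rA: "r \<in> A" using assms(1) roots_subset by auto
  define t where "t = Min {x \<in> A. W x = 2}"
  have fin: "finite {x \<in> A. W x = 2}" using finite_labels by simp
  have "t \<in> {x \<in> A. W x = 2}"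
    unfolding t_def using fin rA r by (intro Min_in) auto
  then have t: "t \<in> A" "W t = 2" by auto
  have min: "t \<le> x" if "x \<in> A" "W x = 2" for x
    unfolding t_def using fin that by (intro Min_le) auto
  have "t \<in> roots"
  proof (rule ccontr)
    assume "t \<notin> roots"
    then obtain y where ty: "(t, y) \<in> step" using t by (auto simp: roots_def)
    have "y \<in> A" using ty by (rule step_in_labels)
    moreover have "W y \<noteq> 2" using ty t by (cases rule: step_cases) auto
    \<comment> \<open>The only root is a row and \<open>y\<close> is not, so the path goes on;
      without diagonals its next label is a row above \<open>t\<close>, against the choice of
      \<open>t\<close>.\<close>
    moreover have "y \<notin> roots" using r assms(1) calculation(2) by auto
    ultimately have "y \<in> Domain step" by (simp add: roots_def)
    then obtain z where yz: "(y, z) \<in> step" by (rule DomainE)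
    have "z \<in> A" using yz by (rule step_in_labels)
    then show False
      using two_steps_from_row(3)[OF ty yz t(2)] assms(2) min[of z] by auto
  qed
  then show ?L using t min row_in_roots_iff[OF t] by blast
qed

lemma leftmost_column_root_iff:
  assumes "roots = {r}" "\<And>x. x \<in> A \<Longrightarrow> W x \<noteq> 1"
  shows "(\<exists>x \<in> A. W x = 0 \<and> (\<forall>x' \<in> A. W x' = 0 \<longrightarrow> x' \<le> x) \<and> (\<forall>i. g i x \<noteq> Some Up_Arrow)) \<longleftrightarrow>
    W r = 0" (is "?L \<longleftrightarrow> _")
proof
  assume ?L
  then obtain x where "x \<in> A" "W x = 0" "\<forall>i. g i x \<noteq> Some Up_Arrow" by auto
  then show "W r = 0" using column_in_roots_iff[of x] assms(1) by simp
next
  assume r: "W r = 0"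
  have rA: "r \<in> A" using assms(1) roots_subset by auto
  define t where "t = Max {x \<in> A. W x = 0}"
  have fin: "finite {x \<in> A. W x = 0}" using finite_labels by simp
  have "t \<in> {x \<in> A. W x = 0}"
    unfolding t_def using fin rA r by (intro Max_in) auto
  then have t: "t \<in> A" "W t = 0" by auto
  have max: "x \<le> t" if "x \<in> A" "W x = 0" for x
    unfolding t_def using fin that by (intro Max_ge) auto
  have "t \<in> roots"
  proof (rule ccontr)
    assume "t \<notin> roots"
    then obtain y where ty: "(t, y) \<in> step" using t by (auto simp: roots_def)
    have "y \<in> A" using ty by (rule step_in_labels)
    moreover have "W y \<noteq> 0" using ty t by (cases rule: step_cases) auto
    moreover have "y \<notin> roots" using r assms(1) calculation(2) by auto
    ultimately have "y \<in> Domain step" by (simp add: roots_def)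
    then obtain z where yz: "(y, z) \<in> step" by (rule DomainE)
    have z: "z \<in> A" using yz by (rule step_in_labels)
    have "W z = 0"
      using two_steps_from_column(4)[OF ty yz t(2)] assms(2)[OF z] by simp
    then show False
      using two_steps_from_column(3)[OF ty yz t(2)] max[OF z] by simp
  qed
  then show ?L using t max column_in_roots_iff[OF t] by blast
qed

end


section \<open>Splitting\<close>

lemma arrow_filling_RAT: "labeled_RAT T \<Longrightarrow> arrow_filling (labels T) (dir T) (arr T)"
  by (simp add: labeled_RAT_iff)

lemma bordered_RAT: "labeled_RAT T \<Longrightarrow> bordered T"
  by (simp add: labeled_RAT_iff)

abbreviation "RAT_step T \<equiv> arrow_filling.step (arr T)"
abbreviation "RAT_roots T \<equiv> arrow_filling.roots (labels T) (arr T)"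
abbreviation "RAT_root T \<equiv> arrow_filling.root (labels T) (arr T)"

definition component :: "labeled_filling \<Rightarrow> nat \<Rightarrow> nat set" where
  "component T r = {x \<in> labels T. RAT_root T x = r}"

lemma component_subset: "component T r \<subseteq> labels T"
  by (auto simp: component_def)

lemma packed_iff: "packed T \<longleftrightarrow> labeled_RAT T \<and> (\<exists>r. RAT_roots T = {r})"
proof (cases "labeled_RAT T")
  case True
  then interpret arrow_filling "labels T" "dir T" "arr T" by (rule arrow_filling_RAT)
  have b: "bordered T" and "\<And>t. filling T t \<noteq> None \<Longrightarrow> t \<in> maximal_tiling (word T)"
    using True by (auto simp: labeled_RAT_iff)
  then have "card {t. filling T t \<noteq> None} = card {(i, j). arr T i j \<noteq> None}"
    by (rule card_filling)
  moreover have "length (word T) = card (labels T)"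
    using b by (simp add: bordered_def)
  ultimately show ?thesis
    using True card_arrows_iff by (simp add: packed_def card_1_singleton_iff)
qed (simp add: packed_def)

lemma spl_components:
  assumes "labeled_RAT T"
  shows "spl T = (\<lambda>r. restrict_RAT T (component T r)) ` RAT_roots T"
proof -
  interpret arrow_filling "labels T" "dir T" "arr T"
    using assms by (rule arrow_filling_RAT)
  have "arrow_equiv T = {(x, y) \<in> labels T \<times> labels T. root x = root y}"
    unfolding arrow_equiv_def arrow_pairs_arr[OF bordered_RAT[OF assms]] by (rule Inter_equiv_arrows)
  then show ?thesis
    by (simp only: spl_def quotient_root image_image component_def)
qed

text \<open>Steps preserve the root, so a component is closed under them; restricting to it keeps
  all its steps, and only \<open>r\<close> is left without one.\<close>

lemma component_props:
  assumes "labeled_RAT T" "r \<in> RAT_roots T"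
  shows "r \<in> component T r"
    and "labeled_RAT (restrict_RAT T (component T r))"
    and "RAT_roots (restrict_RAT T (component T r)) = {r}"
proof -
  interpret arrow_filling "labels T" "dir T" "arr T"
    using assms(1) by (rule arrow_filling_RAT)
  let ?L = "component T r" and ?R = "restrict_RAT T (component T r)"
  show r: "r \<in> ?L"
    using assms(2) roots_subset root_in_roots by (auto simp: component_def)
  show R: "labeled_RAT ?R"
    using assms(1) component_subset by (rule labeled_RAT_restrict)
  interpret R: arrow_filling ?L "dir ?R" "arr ?R"
    using arrow_filling_RAT[OF R] by simp
  have arr: "arr ?R i j = (if i \<in> ?L \<and> j \<in> ?L then arr T i j else None)" for i j
    by (rule arr_restrict[OF bordered_RAT[OF assms(1)] component_subset])
  have step: "R.step = {(x, y) \<in> step. x \<in> ?L \<and> y \<in> ?L}"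
    by (auto simp: R.step_def step_def arr split: if_splits)
  have "x \<in> R.roots \<longleftrightarrow> x = r" if x: "x \<in> ?L" for x
  proof
    assume xr: "x \<in> R.roots"
    show "x = r"
    proof (rule ccontr)
      assume "x \<noteq> r"
      then have "x \<notin> roots"
        using x root_in_roots[of x] by (auto simp: component_def)
      then obtain y where xy: "(x, y) \<in> step"
        using x by (auto simp: roots_def component_def)
      then have "y \<in> ?L"
        using x root_step[OF xy] step_in_labels(2)[OF xy] by (simp add: component_def)
      then show False
        using xy x xr by (auto simp: step R.roots_def)
    qed
  next
    assume "x = r"
    then show "x \<in> R.roots"
      using assms(2) r by (auto simp: step R.roots_def roots_def)
  qed
  then have "R.roots = {r}"
    using r R.roots_subset by auto
  then show "RAT_roots ?R = {r}" by simp
qed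

lemma packed_component:
  "labeled_RAT T \<Longrightarrow> r \<in> RAT_roots T \<Longrightarrow> packed (restrict_RAT T (component T r))"
  using component_props by (simp add: packed_iff)

lemma dir_component_root:
  assumes "labeled_RAT T" "r \<in> RAT_roots T"
  shows "dir (restrict_RAT T (component T r)) r = dir T r"
  using component_props(1)[OF assms] by (rule dir_restrict[OF bordered_RAT[OF assms(1)] component_subset])

lemma inj_on_component:
  assumes "labeled_RAT T"
  shows "inj_on (\<lambda>r. restrict_RAT T (component T r)) (RAT_roots T)"
proof (rule inj_onI)
  fix r r'
  assume r: "r \<in> RAT_roots T" "r' \<in> RAT_roots T"
    and eq: "restrict_RAT T (component T r) = restrict_RAT T (component T r')"
  then have "{r} = {r'}"
    using component_props(3)[OF assms r(1)] component_props(3)[OF assms r(2)] by metis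
  then show "r = r'" by simp
qed

lemma has_size_iff:
  assumes "bordered T"
  shows "has_size T m k \<longleftrightarrow> card (labels T) = m \<and> card {l \<in> labels T. dir T l = 1} = k"
  using assms count_list_rank[of "labels T" "word T" 1]
  by (simp add: has_size_def bordered_def dir_def)

text \<open>Diagonal labels are always roots, so a packed RAT has at most one, and it is then the
  root. This decides the size; without diagonals the top row and leftmost column criteria
  apply.\<close>

lemma packed_type_iffs:
  assumes "labeled_RAT P" "RAT_roots P = {r}"
  shows "horizontal_type P \<longleftrightarrow> dir P r = 2" "vertical_type P \<longleftrightarrow> dir P r = 0"
    "diagonal_type P \<longleftrightarrow> dir P r = 1"
proof -
  interpret arrow_filling "labels P" "dir P" "arr P"
    using assms(1) by (rule arrow_filling_RAT)
  have b: "bordered P" using assms(1) by (rule bordered_RAT)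
  have p: "packed P" using assms by (auto simp: packed_iff)
  have r: "r \<in> labels P" using assms(2) roots_subset by auto
  have d: "l = r" if "l \<in> labels P" "dir P l = 1" for l
    using diagonal_in_roots[OF that] assms(2) by simp
  have diag: "{l \<in> labels P. dir P l = 1} = (if dir P r = 1 then {r} else {})"
  proof (cases "dir P r = 1")
    case True
    then have "{l \<in> labels P. dir P l = 1} = {r}" using d r by blast
    with True show ?thesis by simp
  next
    case False
    then have "{l \<in> labels P. dir P l = 1} = {}" using d by blast
    with False show ?thesis by simp
  qed
  have s0: "(\<exists>m. has_size P m 0) \<longleftrightarrow> dir P r \<noteq> 1" and s1: "(\<exists>m. has_size P m 1) \<longleftrightarrow> dir P r = 1"
    unfolding has_size_iff[OF b] diag by auto
  have nodiag: "dir P l \<noteq> 1" if "dir P r \<noteq> 1" "l \<in> labels P" for l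
    using d[of l] that by metis
  show "diagonal_type P \<longleftrightarrow> dir P r = 1"
    using p s1 by (simp add: diagonal_type_def)
  show "horizontal_type P \<longleftrightarrow> dir P r = 2"
    unfolding horizontal_type_def top_row_free_iff[OF assms(1)] s0
    using p top_row_root_iff[OF assms(2) nodiag] by (cases "dir P r = 1") simp_all
  show "vertical_type P \<longleftrightarrow> dir P r = 0"
    unfolding vertical_type_def leftmost_column_free_iff[OF assms(1)] s0
    using p leftmost_column_root_iff[OF assms(2) nodiag] by (cases "dir P r = 1") simp_all
qed

text \<open>Pieces correspond to roots and a piece shows its type at its root, so counting pieces of
  a type is counting roots of a direction.\<close>

lemma card_spl_type:
  assumes "labeled_RAT T"
    and "\<And>P r. labeled_RAT P \<Longrightarrow> RAT_roots P = {r} \<Longrightarrow> Q P \<longleftrightarrow> dir P r = d"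
  shows "card {P \<in> spl T. Q P} = card {r \<in> RAT_roots T. dir T r = d}"
proof -
  let ?f = "\<lambda>r. restrict_RAT T (component T r)"
  have Q: "Q (?f r) \<longleftrightarrow> dir T r = d" if "r \<in> RAT_roots T" for r
    using assms(2)[OF component_props(2,3)[OF assms(1) that]] dir_component_root[OF assms(1) that]
    by simp
  have "{P \<in> spl T. Q P} = ?f ` {r \<in> RAT_roots T. Q (?f r)}"
    unfolding spl_components[OF assms(1)] by auto
  also have "{r \<in> RAT_roots T. Q (?f r)} = {r \<in> RAT_roots T. dir T r = d}"
    using Q by auto
  finally have "{P \<in> spl T. Q P} = ?f ` {r \<in> RAT_roots T. dir T r = d}" .
  then show ?thesis
    using inj_on_subset[OF inj_on_component[OF assms(1)], of "{r \<in> RAT_roots T. dir T r = d}"]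
    by (simp add: card_image)
qed

lemma card_spl_horizontal:
  assumes "labeled_RAT T"
  shows "card {P \<in> spl T. horizontal_type P} = card {k. row_free T k}"
proof -
  interpret arrow_filling "labels T" "dir T" "arr T"
    using assms by (rule arrow_filling_RAT)
  have "{l \<in> labels T. dir T l = 2 \<and> (\<forall>j. arr T l j \<noteq> Some Left_Arrow)} = {r \<in> roots. dir T r = 2}"
    using row_in_roots_iff roots_subset by blast
  then show ?thesis
    using card_spl_type[OF assms packed_type_iffs(1)] card_row_free[OF assms] by simp
qed

lemma card_spl_vertical:
  assumes "labeled_RAT T"
  shows "card {P \<in> spl T. vertical_type P} = card {k. column_free T k}"
proof -
  interpret arrow_filling "labels T" "dir T" "arr T"
    using assms by (rule arrow_filling_RAT)
  have "{l \<in> labels T. dir T l = 0 \<and> (\<forall>i. arr T i l \<noteq> Some Up_Arrow)} = {r \<in> roots. dir T r = 0}"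
    using column_in_roots_iff roots_subset by blast
  then show ?thesis
    using card_spl_type[OF assms packed_type_iffs(2)] card_column_free[OF assms] by simp
qed

lemma card_spl_diagonal:
  assumes "labeled_RAT T"
  shows "card {P \<in> spl T. diagonal_type P} = count_list (word T) 1"
proof -
  interpret arrow_filling "labels T" "dir T" "arr T"
    using assms by (rule arrow_filling_RAT)
  have "{l \<in> labels T. dir T l = 1} = {r \<in> roots. dir T r = 1}"
    using diagonal_in_roots roots_subset by blast
  then show ?thesis
    using card_spl_type[OF assms packed_type_iffs(3)] has_size_iff[OF bordered_RAT[OF assms], of "card (labels T)" "count_list (word T) 1"]
      bordered_RAT[OF assms]
    by (simp add: has_size_def bordered_def)
qed

section \<open>Splitting is a bijection\<close>

lemma labels_spl:
  assumes "labeled_RAT T"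
  shows "labels ` spl T = component T ` RAT_roots T"
  unfolding spl_components[OF assms] image_image by simp

lemma partition_on_spl:
  assumes "labeled_RAT T"
  shows "partition_on (labels T) (labels ` spl T)"
proof -
  interpret arrow_filling "labels T" "dir T" "arr T"
    using assms by (rule arrow_filling_RAT)
  show ?thesis
    unfolding labels_spl[OF assms] partition_on_def
  proof (intro conjI)
    show "\<Union> (component T ` roots) = labels T"
      using root_props(1) by (auto simp: component_def)
    show "disjoint (component T ` roots)"
      by (auto simp: disjoint_def component_def)
    show "{} \<notin> component T ` roots"
      using component_props(1)[OF assms] by blast
  qed
qed

lemma partition_on_part_eq:
  assumes "partition_on A S" "X \<in> S" "Y \<in> S" "a \<in> X" "a \<in> Y"
  shows "X = Y"
  using disjointD[OF partition_onD2[OF assms(1)] assms(2,3)] assms(4,5) by blast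

lemma spl_in_packed_collections:
  assumes "T \<in> RAT n r"
  shows "spl T \<in> packed_collections n r"
proof -
  have T: "labeled_RAT T" "count_list (word T) 1 = r" "labels T = {1..n}"
    using assms by (auto simp: RAT_def has_size_def)
  have "inj_on labels (spl T)"
    unfolding spl_components[OF T(1)]
    by (rule inj_onI) auto
  moreover have "packed P" if "P \<in> spl T" for P
    using that packed_component[OF T(1)] by (auto simp: spl_components[OF T(1)])
  ultimately show ?thesis
    using partition_on_spl[OF T(1)] card_spl_diagonal[OF T(1)] T
    by (simp add: packed_collections_def)
qed

text \<open>The piece through \<open>l\<close> knows all of \<open>arr T l\<close>: an arrow at
  \<open>(l, j)\<close> puts \<open>j\<close> into the same piece, and elsewhere both sides are
  empty.\<close>

lemma arr_spl:
  assumes "labeled_RAT T" "l \<in> labels T"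
  obtains P where "P \<in> spl T" "l \<in> labels P" "dir P l = dir T l"
    "\<And>j. arr P l j = arr T l j"
proof -
  interpret arrow_filling "labels T" "dir T" "arr T"
    using assms(1) by (rule arrow_filling_RAT)
  let ?L = "component T (root l)"
  let ?P = "restrict_RAT T ?L"
  have l: "l \<in> ?L" using assms(2) by (simp add: component_def)
  have b: "bordered T" using assms(1) by (rule bordered_RAT)
  show ?thesis
  proof (rule that)
    show "?P \<in> spl T"
      unfolding spl_components[OF assms(1)] using root_props(1)[OF assms(2)] by (rule imageI)
    show "l \<in> labels ?P" using l by simp
    show "dir ?P l = dir T l" by (rule dir_restrict[OF b component_subset l])
    show "arr ?P l j = arr T l j" for j
    proof (cases "arr T l j = None")
      case False
      then have "j \<in> ?L"
        using root_arrow[OF False] arrow_inversion[OF False] by (simp add: component_def)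
      then show ?thesis using l by (simp add: arr_restrict[OF b component_subset])
    qed (simp add: arr_restrict[OF b component_subset])
  qed
qed

text \<open>The pieces of \<open>T\<close> and \<open>T'\<close> through a label belong to one
  collection and have overlapping, hence equal label sets. So they coincide, and
  \<open>arr_spl\<close> reads off equal data.\<close>

lemma inj_on_spl: "inj_on spl (RAT n r)"
proof (rule inj_onI)
  fix T T' assume T: "T \<in> RAT n r" "T' \<in> RAT n r" and eq: "spl T = spl T'"
  have R: "labeled_RAT T" "labeled_RAT T'" and L: "labels T = labels T'"
    using T by (auto simp: RAT_def)
  have inj: "inj_on labels (spl T)" and part: "partition_on {1..n} (labels ` spl T)"
    using spl_in_packed_collections[OF T(1)] by (auto simp: packed_collections_def)
  have same: "dir T l = dir T' l \<and> arr T l j = arr T' l j" if l: "l \<in> labels T" for l j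
  proof -
    obtain P where P: "P \<in> spl T" "l \<in> labels P" "dir P l = dir T l" "\<And>j. arr P l j = arr T l j"
      using arr_spl[OF R(1) l] by blast
    obtain P' where P': "P' \<in> spl T" "l \<in> labels P'" "dir P' l = dir T' l" "\<And>j. arr P' l j = arr T' l j"
      using arr_spl[OF R(2)] l L eq by metis
    have "labels P = labels P'"
      using part imageI[OF P(1)] imageI[OF P'(1)] P(2) P'(2) by (rule partition_on_part_eq)
    then have "P = P'" using P(1) P'(1) by (rule inj_onD[OF inj])
    then show ?thesis using P P' by metis
  qed
  show "T = T'"
  proof (rule labeled_RAT_eqI[OF R L])
    show "dir T l = dir T' l" if "l \<in> labels T" for l
      using same[OF that] by simp
    show "arr T i j = arr T' i j" for i j
    proof (cases "i \<in> labels T")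
      case True
      then show ?thesis using same by simp
    next
      case False
      then show ?thesis using L by (simp add: arr_def label_inversions_def)
    qed
  qed
qed

text \<open>The preimage is glued: every label takes its data from its own piece, and cells between
  different pieces stay empty.\<close>

lemma spl_surj:
  assumes "C \<in> packed_collections n r"
  shows "C \<in> spl ` RAT n r"
proof -
  have packed: "\<And>P. P \<in> C \<Longrightarrow> packed P" and inj: "inj_on labels C"
    and part: "partition_on {1..n} (labels ` C)" and diag: "card {P \<in> C. diagonal_type P} = r"
    using assms by (auto simp: packed_collections_def)
  have R: "labeled_RAT P" if "P \<in> C" for P
    using packed[OF that] by (simp add: packed_iff)
  define block where "block l = (THE P. P \<in> C \<and> l \<in> labels P)" for l
  have block: "block l = P" if "P \<in> C" "l \<in> labels P" for l P
    unfolding block_def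
  proof (rule the_equality)
    fix Q assume Q: "Q \<in> C \<and> l \<in> labels Q"
    then have "labels Q = labels P"
      using partition_on_part_eq[OF part] that by blast
    then show "Q = P" using inj Q that(1) by (auto dest: inj_onD)
  qed (use that in simp)
  have ex_block: "\<exists>P \<in> C. l \<in> labels P" if "l \<in> {1..n}" for l
    using that partition_onD1[OF part] by auto
  have block_labels: "labels P \<subseteq> {1..n}" if "P \<in> C" for P
    using that partition_onD1[OF part] by auto
  define W where "W l = dir (block l) l" for l
  \<comment> \<open>Consulting the piece of \<open>i\<close> suffices: if \<open>j\<close> lies
    elsewhere the value is \<open>None\<close>, since \<open>arr\<close> vanishes off the labels of
    its RAT.\<close>
  define g where "g i j = (if i \<in> {1..n} then arr (block i) i j else None)" for i j
  have gP: "g i j = arr P i j" if "P \<in> C" "i \<in> labels P" for i j P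
    using that block[OF that] block_labels[OF that(1)] by (auto simp: g_def)
  have WP: "W l = dir P l" if "P \<in> C" "l \<in> labels P" for l P
    using block[OF that] by (simp add: W_def)
  have g_in: "\<exists>P \<in> C. i \<in> labels P \<and> j \<in> labels P \<and> arr P i j = g i j" if "g i j \<noteq> None" for i j
  proof -
    have "i \<in> {1..n}" using that by (auto simp: g_def split: if_splits)
    then obtain P where P: "P \<in> C" "i \<in> labels P" using ex_block by auto
    interpret P: arrow_filling "labels P" "dir P" "arr P"
      using R[OF P(1)] by (rule arrow_filling_RAT)
    show ?thesis
      using P gP[OF P, of j] P.arrow_inversion[of i j] that by auto
  qed
  \<comment> \<open>The piece of the second label gives the same value; this serves up-arrows, where
    the second label is fixed and the first varies.\<close>
  have gP': "g i j = arr P i j" if P: "P \<in> C" "j \<in> labels P" for i j P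
  proof (cases "g i j = None")
    case True
    show ?thesis
    proof (rule ccontr)
      assume "g i j \<noteq> arr P i j"
      then have "arr P i j \<noteq> None" using True by simp
      then have "i \<in> labels P"
        using arrow_filling.arrow_inversion[OF arrow_filling_RAT[OF R[OF P(1)]], of i j] by simp
      then show False using gP[OF P(1)] \<open>g i j \<noteq> arr P i j\<close> by simp
    qed
  next
    case False
    then obtain Q where "Q \<in> C" "j \<in> labels Q" "arr Q i j = g i j" using g_in by blast
    then show ?thesis using block P by metis
  qed
  have glue: "arrow_filling {1..n} W g"
  proof
    show "finite {1..n}" by simp
    show "W l \<in> {0, 1, 2}" if "l \<in> {1..n}" for l
    proof -
      obtain P where P: "P \<in> C" "l \<in> labels P" using ex_block[OF \<open>l \<in> {1..n}\<close>] by auto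
      show ?thesis
        unfolding WP[OF P] using arrow_filling.dirs[OF arrow_filling_RAT[OF R[OF P(1)]] P(2)] .
    qed
  next
    fix i j assume "g i j \<noteq> None"
    then obtain P where P: "P \<in> C" "i \<in> labels P" "j \<in> labels P" "arr P i j \<noteq> None"
      using g_in[of i j] by force
    interpret P: arrow_filling "labels P" "dir P" "arr P"
      using R[OF P(1)] by (rule arrow_filling_RAT)
    show "i \<in> {1..n} \<and> j \<in> {1..n} \<and> i < j \<and> W j < W i"
      using P.arrow_inversion[OF P(4)] block_labels[OF P(1)] WP[OF P(1)] by auto
  next
    fix i j assume g: "g i j = Some Left_Arrow"
    then obtain P where P: "P \<in> C" "i \<in> labels P" "arr P i j = Some Left_Arrow"
      using g_in[of i j] by force
    interpret P: arrow_filling "labels P" "dir P" "arr P"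
      using R[OF P(1)] by (rule arrow_filling_RAT)
    show "W i = 2" using P.left_row[OF P(3)] WP[OF P(1,2)] by simp
    show "g i j' = None" if "j < j'" for j'
      using P.left_west[OF P(3) that] gP[OF P(1,2)] by simp
  next
    fix i j assume g: "g i j = Some Up_Arrow"
    then obtain P where P: "P \<in> C" "i \<in> labels P" "j \<in> labels P" "arr P i j = Some Up_Arrow"
      using g_in[of i j] by force
    interpret P: arrow_filling "labels P" "dir P" "arr P"
      using R[OF P(1)] by (rule arrow_filling_RAT)
    show "W j = 0" using P.up_column[OF P(4)] WP[OF P(1,3)] by simp
    show "g i' j = None" if "W i' < W i \<or> W i' = W i \<and> i' < i" for i'
    proof (rule ccontr)
      assume "g i' j \<noteq> None"
      \<comment> \<open>A nonempty cell in column \<open>j\<close> belongs to the piece of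
        \<open>j\<close>, where the conflict is already excluded.\<close>
      then have ne: "arr P i' j \<noteq> None" using gP'[OF P(1,3)] by simp
      then have "i' \<in> labels P" using P.arrow_inversion by blast
      then have "dir P i' < dir P i \<or> dir P i' = dir P i \<and> i' < i"
        using that WP[OF P(1)] P(2) by simp
      then have "arr P i' j = None" by (rule P.up_north[OF P(4)])
      with ne show False by simp
    qed
  qed
  define T where "T = make_filling {1..n} W g"
  have T: "labeled_RAT T" "labels T = {1..n}" "\<And>l. l \<in> {1..n} \<Longrightarrow> dir T l = W l"
    "\<And>i j. arr T i j = g i j"
    using labeled_RAT_make[OF glue] labels_make[OF glue] dir_make[OF glue] arr_make[OF glue]
    by (simp_all add: T_def)
  interpret T: arrow_filling "labels T" "dir T" "arr T"
    using T(1) by (rule arrow_filling_RAT)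
  have bT: "bordered T" using T(1) by (rule bordered_RAT)
  \<comment> \<open>Steps of the glued RAT neither leave nor enter a piece, and inside it they are
    the steps of the piece; so the piece is a whole component with the same root.\<close>
  have block_root: "\<exists>r. r \<in> T.roots \<and> component T r = labels P" if P: "P \<in> C" for P
  proof -
    interpret P: arrow_filling "labels P" "dir P" "arr P"
      using R[OF P] by (rule arrow_filling_RAT)
    obtain r where r: "P.roots = {r}" using packed[OF P] by (auto simp: packed_iff)
    have rP: "r \<in> labels P" using r P.roots_subset by auto
    have sub: "P.step \<subseteq> T.step"
    proof (rule subrelI)
      fix x y assume xy: "(x, y) \<in> P.step"
      have "x \<in> labels P" "y \<in> labels P" using xy by (rule P.step_in_labels)+
      then have "g x y = arr P x y" "g y x = arr P y x"
        using gP[OF P] by auto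
      then show "(x, y) \<in> T.step"
        using xy by (simp add: P.step_def T.step_def T(4))
    qed
    have closed: "(x, y) \<in> P.step" if "(x, y) \<in> T.step" "x \<in> labels P" for x y
      using that gP[OF P that(2)] gP'[OF P that(2)] by (simp add: P.step_def T.step_def T(4))
    have "r \<notin> Domain P.step" using r by (auto simp: P.roots_def)
    then have "r \<notin> Domain T.step" using closed rP by blast
    moreover have "r \<in> labels T" using rP block_labels[OF P] unfolding T(2) by blast
    ultimately have rT: "r \<in> T.roots" unfolding T.roots_def by blast
    have root: "T.root x = r" if "x \<in> labels P" for x
    proof (rule T.root_eqI[OF _ rT])
      have "(x, r) \<in> P.step\<^sup>*"
        using P.root_props[OF that] r by simp
      then show "(x, r) \<in> T.step\<^sup>*"
        using rtrancl_mono[OF sub] by blast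
    qed
    have "x \<in> labels P" if x: "x \<in> labels T" "T.root x = r" for x
    proof -
      have reach: "y \<in> labels P \<longleftrightarrow> x \<in> labels P" if "(x, y) \<in> T.step\<^sup>*" for y
        using that
      proof induction
        case (step y z)
        have "y \<in> labels P \<longleftrightarrow> z \<in> labels P"
        proof
          assume "y \<in> labels P"
          then show "z \<in> labels P" using closed[OF step(2)] P.step_in_labels by blast
        next
          assume z: "z \<in> labels P"
          have "g y z \<noteq> None \<or> g z y \<noteq> None"
            using step(2) by (auto simp: T.step_def T(4))
          then have "arr P y z \<noteq> None \<or> arr P z y \<noteq> None"
            using gP[OF P z] gP'[OF P z] by simp
          then show "y \<in> labels P" using P.arrow_inversion by blast
        qed
        then show ?case using step by simp
      qed simp
      show ?thesis using reach[OF T.root_props(2)[OF x(1)]] x(2) rP by simp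
    qed
    moreover have "labels P \<subseteq> labels T" using block_labels[OF P] unfolding T(2) .
    ultimately have "component T r = labels P"
      unfolding component_def using root by blast
    then show ?thesis using rT by blast
  qed
  have restrict: "restrict_RAT T (labels P) = P" if P: "P \<in> C" for P
  proof (rule labeled_RAT_eqI)
    have sub: "labels P \<subseteq> labels T" using block_labels[OF P] T(2) by simp
    show "labeled_RAT (restrict_RAT T (labels P))" using T(1) sub by (rule labeled_RAT_restrict)
    show "labeled_RAT P" using P by (rule R)
    show "labels (restrict_RAT T (labels P)) = labels P" by simp
    show "dir (restrict_RAT T (labels P)) l = dir P l"
      if "l \<in> labels (restrict_RAT T (labels P))" for l
      using that dir_restrict[OF bT sub, of l] T(2) T(3)[of l] WP[OF P, of l] sub by auto
    show "arr (restrict_RAT T (labels P)) i j = arr P i j" for i j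
    proof (cases "i \<in> labels P \<and> j \<in> labels P")
      case True
      then show ?thesis using gP[OF P] by (simp add: arr_restrict[OF bT sub] T(4))
    next
      case False
      then show ?thesis
        by (auto simp: arr_restrict[OF bT sub] arr_def[of P] label_inversions_def)
    qed
  qed
  have "spl T = C"
  proof (rule subset_antisym; rule subsetI)
    fix P assume P: "P \<in> C"
    obtain r where r: "r \<in> T.roots" "component T r = labels P"
      using block_root[OF P] by blast
    have "restrict_RAT T (component T r) = P" unfolding r(2) using P by (rule restrict)
    then show "P \<in> spl T"
      unfolding spl_components[OF T(1)] using r(1) by blast
  next
    fix Q assume "Q \<in> spl T"
    then obtain r where r: "r \<in> T.roots" "Q = restrict_RAT T (component T r)"
      by (auto simp: spl_components[OF T(1)])
    have "r \<in> {1..n}" using subsetD[OF T.roots_subset r(1)] unfolding T(2) .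
    then obtain P where P: "P \<in> C" "r \<in> labels P"
      using ex_block by blast
    obtain r' where r': "r' \<in> T.roots" "component T r' = labels P"
      using block_root[OF P(1)] by blast
    have "r \<in> component T r'" unfolding r'(2) by (rule P(2))
    then have "r = r'"
      using T.root_in_roots[OF r(1)] by (simp add: component_def)
    then have "Q = restrict_RAT T (labels P)" using r(2) r'(2) by simp
    then show "Q \<in> C" using restrict[OF P(1)] P(1) by simp
  qed
  \<comment> \<open>The number of diagonal border steps is recovered from the number of diagonal
    pieces.\<close>
  moreover have "T \<in> RAT n r"
    using T(1,2) card_spl_diagonal[OF T(1)] diag \<open>spl T = C\<close> bT
    by (simp add: RAT_def has_size_def bordered_def)
  ultimately show ?thesis by blast
qed

theorem theorem3p2:
  fixes n r :: nat
  assumes "r \<le> n"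
  shows "bij_betw spl (RAT n r) (packed_collections n r) \<and>
    (\<forall>T \<in> RAT n r.
      card {P \<in> spl T. horizontal_type P} = card {k. row_free T k} \<and>
      card {P \<in> spl T. vertical_type P} = card {k. column_free T k})"
proof (intro conjI ballI)
  show "bij_betw spl (RAT n r) (packed_collections n r)"
    using inj_on_spl spl_in_packed_collections spl_surj by (auto intro!: bij_betw_imageI)
next
  fix T assume "T \<in> RAT n r"
  then have "labeled_RAT T" by (simp add: RAT_def)
  then show "card {P \<in> spl T. horizontal_type P} = card {k. row_free T k}"
    "card {P \<in> spl T. vertical_type P} = card {k. column_free T k}"
    by (rule card_spl_horizontal card_spl_vertical)+
qed

end
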